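(* Let $G$ be a stochastic context-free grammar with start symbol $S$ and terminal alphabet $\Sigma$ that is proper, consistent, has no useless nonterminals, and has no null productions. Let $x=x_0\cdots x_{l-1}\in\Sigma^*$. Let $R_L=(R(Z\stackrel{*}{\Rightarrow}_L Y))_{Z,Y}$ and $R_U=(R(Z\stackrel{*}{\Rightarrow}Y))_{Z,Y}$ be the probabilistic reflexive, transitive left-corner and unit-production relations of $G$. Then the forward probabilities $\alpha$ and inner probabilities $\gamma$ relative to $x$ satisfy $\alpha_0({}_0\to.S)=\gamma_0({}_0\to.S)=1$ and the following recurrences. Prediction: for every $0\le i\le l$ and every production $Y\to\nu$ such that the state $i:{}_iY\to.\nu$ is in the Earley chart for $x$, $$\alpha_i({}_iY\to.\nu)=\sum_{i:\,{}_kX\to\lambda.Z\mu}\alpha_i({}_kX\to\lambda.Z\mu)\,R(Z\stackrel{*}{\Rightarrow}_L Y)\,P(Y\to\nu),\qquad \gamma_i({}_iY\to.\nu)=P(Y\to\nu),$$ where the sum is over all states at position $i$ with a nonterminal $Z$ to the right of the dot that are either the initial state or have a nonempty string $\lambda$ to the left of the dot (i.e. are not themselves predicted states). Scanning: for every $0\le i<l$ and every state $i:{}_kX\to\lambda.a\mu$ in the chart with terminal $a=x_i$, $$\alpha_{i+1}({}_kX\to\lambda a.\mu)=\alpha_i({}_kX\to\lambda.a\mu),\qquad \gamma_{i+1}({}_kX\to\lambda a.\mu)=\gamma_i({}_kX\to\lambda.a\mu).$$ Completion: for every state $i:{}_kX\to\lambda Z.\mu$ in the chart with $Z$ a nonterminal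 immediately to the left of the dot, $$\alpha_i({}_kX\to\lambda Z.\mu)=\sum_{j,\,Y\to\nu}\alpha_j({}_kX\to\lambda.Z\mu)\,\gamma_i({}_jY\to\nu.)\,R(Z\stackrel{*}{\Rightarrow}Y),$$ $$\gamma_i({}_kX\to\lambda Z.\mu)=\sum_{j,\,Y\to\nu}\gamma_j({}_kX\to\lambda.Z\mu)\,\gamma_i({}_jY\to\nu.)\,R(Z\stackrel{*}{\Rightarrow}Y),$$ where the sums are over all $k\le j<i$ and all productions $Y\to\nu$ that are not unit productions (i.e. $|\nu|>1$ or $\nu\in\Sigma$).
   Context: Grammar. A stochastic context-free grammar (SCFG) $G$ is a context-free grammar (finite sets of nonterminals, terminals $\Sigma$, and productions; start symbol $S$) with a probability $P(X\to\lambda)\in[0,1]$ attached to each production $X\to\lambda$. No null productions: every right-hand side $\lambda$ is nonempty. The probability of a derivation is the product of the probabilities of the productions applied in its steps, and $P(X\stackrel{*}{\Rightarrow}x)$ is the sum of the probabilities of all left-most derivations of $x\in\Sigma^*$ from $X$. $G$ is proper if for each nonterminal $X$ the probabilities of all productions with left-hand side $X$ sum to $1$; consistent if $\sum_{x\in\Sigma^*}P(S\stackrel{*}{\Rightarrow}x)=1$; has no useless nonterminals if every nonterminal $X$ appears in some derivation of nonzero probability of some terminal string, $S\stackrel{*}{\Rightarrow}\lambda X\mu\stackrel{*}{\Rightarrow}x\in\Sigma^*$. Left-corner and unit-production relations. $P_L$ is the matrix indexed by nonterminals with entries $P(X\to_L Y)=\sum_{X\to Y\lambda\in G}P(X\to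 Y\lambda)$ (sum over productions for $X$ whose right-hand side starts with $Y$). $P_U$ is the matrix indexed by nonterminals with entries $P(X\to Y)$, the probability of the unit production $X\to Y$ ($0$ if there is none). $R_L=\sum_{n\ge0}P_L^n=(I-P_L)^{-1}$ has entries $R(X\stackrel{*}{\Rightarrow}_LY)$ and $R_U=\sum_{n\ge0}P_U^n=(I-P_U)^{-1}$ has entries $R(X\stackrel{*}{\Rightarrow}Y)$. Earley states and chart. A state is written $i:\ {}_kX\to\lambda.\mu$, with $0\le k\le i$ integers and $X\to\lambda\mu$ a production; additionally there are dummy states with empty left-hand side, coming from a dummy production $\to S$: the initial state $0:{}_0\to.S$ and states $i:{}_0\to S.$. A state is complete if nothing is to the right of the dot. A predicted state is one of the form $i:{}_iY\to.\nu$ with $Y\to\nu$ a production of $G$. The Earley chart for $x$ is the smallest set of states containing the initial state and closed under: prediction (from $i:{}_kX\to\lambda.Y\mu$, $Y$ a nonterminal, add $i:{}_iY\to.\nu$ for every production $Y\to\nu$); scanning (from $i:{}_kX\to\lambda.a\mu$ with $i<l$ and terminal $a=x_i$, add $i+1:{}_kX\to\lambda a.\mu$); completion (from $i:{}_jY\to\nu.$ and $j:{}_kX\to\lambda.Y\mu$ with $j<i$, add $i:{}_kX\to\lambda Y.\mu$). In the prediction, scanning and completion rules defining the Earley chart, in the definitions of paths and of forward and inner probabilities, and in the recurrences of the claim, the left-hand side $X$ of a state ${}_kX\to\lambda.\mu$ may be empty, in which case the state is one of the dummy states $0:{}_0\to.S$ or $i:{}_0\to S.$. Paths. A path is a finite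 sequence of states $s_1,\dots,s_m$ ($m\ge1$), where $s_1$ is the initial state or a predicted state, together with a root index $\rho(t)$ for each $t$, with $\rho(1)=1$, such that each $s_{t+1}$ arises by one of: - Prediction: $s_t=(i:{}_kX\to\lambda.Y\mu)$, $s_{t+1}=(i:{}_iY\to.\nu)$ for some production $Y\to\nu$; $\rho(t+1)=t+1$. - Scanning (of an arbitrary terminal $a$): $s_t=(i:{}_kX\to\lambda.a\mu)$, $s_{t+1}=(i+1:{}_kX\to\lambda a.\mu)$; $\rho(t+1)=\rho(t)$. - Completion: $s_t=(i:{}_jY\to\nu.)$ is complete, $\rho(t)>1$, and $s_{\rho(t)-1}=(j:{}_kX\to\lambda.Y\mu)$ is the state from which that expansion of $Y$ was predicted; $s_{t+1}=(i:{}_kX\to\lambda Y.\mu)$; $\rho(t+1)=\rho(\rho(t)-1)$. The length of a path is its number of scanning steps; it generates the string of terminals scanned, in order. Its probability is the product of $P(Y\to\nu)$ over all occurrences of predicted states ${}_iY\to.\nu$ on it, including the first state if it is predicted (the dummy production contributes factor $1$). Forward and inner probabilities (relative to $x$). The forward probability $\alpha_i({}_kX\to\lambda.\mu)$ is the sum of the probabilities of all paths of length $i$ that start with the initial state, generate $x_0\cdots x_{i-1}$, and end in the state $i:{}_kX\to\lambda.\mu$. The inner probability $\gamma_i({}_kX\to\lambda.\mu)$ is the sum of the probabilities of all paths $s_1,\dots,s_m$ of length $i-k$ that start in $s_1=(k:{}_kX\to.\lambda\mu)$, end in $s_m=(i:{}_kX\to\lambda.\mu)$ with $\rho(m)=1$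 (the last state is the first state with its dot moved), and generate $x_k\cdots x_{i-1}$. Empty sums are $0$; states not reached by any such path have value $0$. *)

theory Defs
  imports "HOL-Analysis.Analysis"
begin

section \<open>Stochastic context-free grammars\<close>

datatype ('n, 't) sym = NT 'n | Tm 't

text \<open>The (finite) sets of nonterminals and terminals are the types \<open>'n\<close> and \<open>'t\<close>; only
  \<open>prob G r\<close> for \<open>r \<in> prods G\<close> is meaningful.\<close>

record ('n, 't) scfg =
  start :: 'n
  prods :: "('n \<times> ('n, 't) sym list) set"
  prob :: "'n \<times> ('n, 't) sym list \<Rightarrow> real"

definition is_scfg :: "('n::finite, 't::finite) scfg \<Rightarrow> bool" where
  "is_scfg G \<longleftrightarrow> finite (prods G) \<and> (\<forall>r\<in>prods G. 0 \<le> prob G r \<and> prob G r \<le> 1)"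

definition no_null_productions :: "('n, 't) scfg \<Rightarrow> bool" where
  "no_null_productions G \<longleftrightarrow> (\<forall>(X, \<nu>)\<in>prods G. \<nu> \<noteq> [])"

definition proper :: "('n, 't) scfg \<Rightarrow> bool" where
  "proper G \<longleftrightarrow> (\<forall>X. (\<Sum>\<nu> | (X, \<nu>) \<in> prods G. prob G (X, \<nu>)) = 1)"

text \<open>The list records the productions applied, in order.\<close>

inductive derivation ::
  "('n, 't) scfg \<Rightarrow> ('n, 't) sym list \<Rightarrow> ('n \<times> ('n, 't) sym list) list \<Rightarrow> ('n, 't) sym list \<Rightarrow> bool"
  for G where
  refl: "derivation G u [] u"
| step: "(X, \<nu>) \<in> prods G \<Longrightarrow> derivation G (u @ \<nu> @ v) ps w
    \<Longrightarrow> derivation G (u @ NT X # v) ((X, \<nu>) # ps) w"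

text \<open>A left-most derivation is determined by its first sentential form together with the list of
  productions, so summing over such lists is summing over left-most derivations.\<close>

inductive leftmost_derivation ::
  "('n, 't) scfg \<Rightarrow> ('n, 't) sym list \<Rightarrow> ('n \<times> ('n, 't) sym list) list \<Rightarrow> ('n, 't) sym list \<Rightarrow> bool"
  for G where
  refl: "leftmost_derivation G u [] u"
| step: "(X, \<nu>) \<in> prods G \<Longrightarrow> leftmost_derivation G (map Tm u @ \<nu> @ v) ps w
    \<Longrightarrow> leftmost_derivation G (map Tm u @ NT X # v) ((X, \<nu>) # ps) w"

definition derivation_prob :: "('n, 't) scfg \<Rightarrow> ('n \<times> ('n, 't) sym list) list \<Rightarrow> real" where
  "derivation_prob G ps = prod_list (map (prob G) ps)"

definition string_prob :: "('n, 't) scfg \<Rightarrow> 'n \<Rightarrow> 't list \<Rightarrow> real" where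
  "string_prob G X x =
    (\<Sum>\<^sub>\<infinity>ps\<in>{ps. leftmost_derivation G [NT X] ps (map Tm x)}. derivation_prob G ps)"

definition consistent :: "('n, 't) scfg \<Rightarrow> bool" where
  "consistent G \<longleftrightarrow> ((\<lambda>x. string_prob G (start G) x) has_sum 1) UNIV"

definition no_useless_nonterminals :: "('n, 't) scfg \<Rightarrow> bool" where
  "no_useless_nonterminals G \<longleftrightarrow>
    (\<forall>X. \<exists>u v ps qs x. derivation G [NT (start G)] ps (u @ NT X # v) \<and>
       derivation G (u @ NT X # v) qs (map Tm x) \<and> derivation_prob G (ps @ qs) \<noteq> 0)"

section \<open>Left-corner and unit-production relations\<close>

definition left_corner_matrix :: "('n::finite, 't) scfg \<Rightarrow> real ^ 'n ^ 'n" where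
  "left_corner_matrix G = (\<chi> X Y. \<Sum>\<nu> | (X, NT Y # \<nu>) \<in> prods G. prob G (X, NT Y # \<nu>))"

definition unit_matrix :: "('n::finite, 't) scfg \<Rightarrow> real ^ 'n ^ 'n" where
  "unit_matrix G = (\<chi> X Y. if (X, [NT Y]) \<in> prods G then prob G (X, [NT Y]) else 0)"

text \<open>The overloaded power on \<open>real ^ 'n ^ 'n\<close> is componentwise, hence this definition.\<close>

definition matrix_pow :: "real ^ 'n ^ 'n \<Rightarrow> nat \<Rightarrow> real ^ 'n ^ 'n" where
  "matrix_pow A n = (((**) A) ^^ n) (mat 1)"

definition R_L :: "('n::finite, 't) scfg \<Rightarrow> real ^ 'n ^ 'n" where
  "R_L G = (\<Sum>n. matrix_pow (left_corner_matrix G) n)"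

definition R_U :: "('n::finite, 't) scfg \<Rightarrow> real ^ 'n ^ 'n" where
  "R_U G = (\<Sum>n. matrix_pow (unit_matrix G) n)"

section \<open>Earley states and chart\<close>

text \<open>\<open>State i k X \<beta> \<mu>\<close> stands for \<open>i: \<^sub>kX \<rightarrow> \<beta>.\<mu>\<close>; the left-hand side \<open>None\<close> is the empty one of
  the dummy states.\<close>

datatype ('n, 't) state =
  State (pos: nat) (origin: nat) (lhs: "'n option")
    (before: "('n, 't) sym list") (after: "('n, 't) sym list")

definition initial_state :: "('n, 't) scfg \<Rightarrow> ('n, 't) state" where
  "initial_state G = State 0 0 None [] [NT (start G)]"

fun is_state :: "('n, 't) scfg \<Rightarrow> ('n, 't) state \<Rightarrow> bool" where
  "is_state G (State i k (Some X) \<beta> \<mu>) \<longleftrightarrow> k \<le> i \<and> (X, \<beta> @ \<mu>) \<in> prods G"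
| "is_state G (State i k None \<beta> \<mu>) \<longleftrightarrow>
    State i k None \<beta> \<mu> = initial_state G \<or> k = 0 \<and> \<beta> = [NT (start G)] \<and> \<mu> = []"

definition is_predicted :: "('n, 't) scfg \<Rightarrow> ('n, 't) state \<Rightarrow> bool" where
  "is_predicted G s \<longleftrightarrow> (\<exists>i Y \<nu>. (Y, \<nu>) \<in> prods G \<and> s = State i i (Some Y) [] \<nu>)"

inductive_set chart :: "('n, 't) scfg \<Rightarrow> 't list \<Rightarrow> ('n, 't) state set" for G x where
  init: "initial_state G \<in> chart G x"
| predict: "State i k X \<beta> (NT Y # \<mu>) \<in> chart G x \<Longrightarrow> (Y, \<nu>) \<in> prods G
    \<Longrightarrow> State i i (Some Y) [] \<nu> \<in> chart G x"
| scan: "State i k X \<beta> (Tm a # \<mu>) \<in> chart G x \<Longrightarrow> i < length x \<Longrightarrow> a = x ! i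
    \<Longrightarrow> State (Suc i) k X (\<beta> @ [Tm a]) \<mu> \<in> chart G x"
| complete: "State i j (Some Y) \<nu> [] \<in> chart G x \<Longrightarrow> State j k X \<beta> (NT Y # \<mu>) \<in> chart G x \<Longrightarrow> j < i
    \<Longrightarrow> State i k X (\<beta> @ [NT Y]) \<mu> \<in> chart G x"

section \<open>Paths\<close>

text \<open>A path is a list of states paired with their root indices. List positions and root indices
  count from \<open>0\<close>, so the root index of the first state is \<open>0\<close>, and the state from which the
  expansion with root index \<open>r > 0\<close> was predicted is at position \<open>r - 1\<close>.\<close>

type_synonym ('n, 't) path = "(('n, 't) state \<times> nat) list"

definition prediction_step :: "('n, 't) scfg \<Rightarrow> ('n, 't) path \<Rightarrow> nat \<Rightarrow> bool" where
  "prediction_step G p t \<longleftrightarrow> (\<exists>i k X \<beta> Y \<mu> \<nu>.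
     fst (p ! t) = State i k X \<beta> (NT Y # \<mu>) \<and> (Y, \<nu>) \<in> prods G \<and>
     p ! Suc t = (State i i (Some Y) [] \<nu>, Suc t))"

definition scanning_step :: "('n, 't) path \<Rightarrow> nat \<Rightarrow> bool" where
  "scanning_step p t \<longleftrightarrow> (\<exists>i k X \<beta> a \<mu>.
     fst (p ! t) = State i k X \<beta> (Tm a # \<mu>) \<and>
     p ! Suc t = (State (Suc i) k X (\<beta> @ [Tm a]) \<mu>, snd (p ! t)))"

definition completion_step :: "('n, 't) path \<Rightarrow> nat \<Rightarrow> bool" where
  "completion_step p t \<longleftrightarrow> (\<exists>i j k X \<beta> Y \<mu> \<nu>.
     fst (p ! t) = State i j (Some Y) \<nu> [] \<and> snd (p ! t) > 0 \<and>
     fst (p ! (snd (p ! t) - 1)) = State j k X \<beta> (NT Y # \<mu>) \<and>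
     p ! Suc t = (State i k X (\<beta> @ [NT Y]) \<mu>, snd (p ! (snd (p ! t) - 1))))"

definition is_path :: "('n, 't) scfg \<Rightarrow> ('n, 't) path \<Rightarrow> bool" where
  "is_path G p \<longleftrightarrow> p \<noteq> [] \<and>
     (fst (hd p) = initial_state G \<or> is_predicted G (fst (hd p))) \<and> snd (hd p) = 0 \<and>
     (\<forall>t. Suc t < length p \<longrightarrow> prediction_step G p t \<or> scanning_step p t \<or> completion_step p t)"

text \<open>On a path, a state with a terminal \<open>a\<close> after the dot can only be left by scanning \<open>a\<close>, so the
  scanned terminals can be read off all states but the last one.\<close>

fun scanned :: "('n, 't) state \<Rightarrow> 't list" where
  "scanned (State i k X \<beta> (Tm a # \<mu>)) = [a]"
| "scanned _ = []"

definition generated :: "('n, 't) path \<Rightarrow> 't list" where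
  "generated p = concat (map (\<lambda>(s, r). scanned s) (butlast p))"

definition path_length :: "('n, 't) path \<Rightarrow> nat" where
  "path_length p = length (generated p)"

definition state_factor :: "('n, 't) scfg \<Rightarrow> ('n, 't) state \<Rightarrow> real" where
  "state_factor G s = (if is_predicted G s then prob G (the (lhs s), after s) else 1)"

definition path_prob :: "('n, 't) scfg \<Rightarrow> ('n, 't) path \<Rightarrow> real" where
  "path_prob G p = (\<Prod>(s, r)\<leftarrow>p. state_factor G s)"

section \<open>Forward and inner probabilities\<close>

definition forward_paths :: "('n, 't) scfg \<Rightarrow> 't list \<Rightarrow> ('n, 't) state \<Rightarrow> ('n, 't) path set" where
  "forward_paths G x s = {p. is_path G p \<and> fst (hd p) = initial_state G \<and> fst (last p) = s \<and>
     path_length p = pos s \<and> generated p = take (pos s) x}"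

definition inner_paths :: "('n, 't) scfg \<Rightarrow> 't list \<Rightarrow> ('n, 't) state \<Rightarrow> ('n, 't) path set" where
  "inner_paths G x s = {p. is_path G p \<and>
     fst (hd p) = State (origin s) (origin s) (lhs s) [] (before s @ after s) \<and>
     fst (last p) = s \<and> snd (last p) = 0 \<and>
     path_length p = pos s - origin s \<and> generated p = take (pos s - origin s) (drop (origin s) x)}"

definition forward_prob :: "('n, 't) scfg \<Rightarrow> 't list \<Rightarrow> ('n, 't) state \<Rightarrow> real" where
  "forward_prob G x s = (\<Sum>\<^sub>\<infinity>p\<in>forward_paths G x s. path_prob G p)"

definition inner_prob :: "('n, 't) scfg \<Rightarrow> 't list \<Rightarrow> ('n, 't) state \<Rightarrow> real" where
  "inner_prob G x s = (\<Sum>\<^sub>\<infinity>p\<in>inner_paths G x s. path_prob G p)"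

end

(* A path that ends by completing Z splits uniquely at the root index of the completed expansion
   into a path to the state that predicted Z and an inner path for a production Z -> nu, and the
   path probability is multiplicative under this splitting.  Likewise the last scanning or
   prediction step of a path can be stripped off.  Summing over paths in [0, infinity] turns these
   bijections into one-step recurrences: the completed expansions g of Z satisfy g = h + P_U g,
   where h collects the non-unit productions, and the total forward weight a of the states
   expecting Z satisfies a = b + a P_L, where b collects the non-predicted ones.

   Solving these gives g = R_U h and a = b R_L once g and a are known to be finite.  Finiteness
   comes from restricting to paths of at most N states: the restricted sums satisfy
   u_(N+1) <= h + P u_N with u_0 = 0, so they are bounded by R h uniformly in N.

   The series for R_L converges because in a proper grammar a set of nonterminals whose left-corner
   chains never lose mass could not derive a terminal string; P_U is dominated by P_L. *)

theory Submission imports Defs begin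

section \<open>Neumann series of nonnegative matrices\<close>

text \<open>A state can be the end of infinitely many paths: cycles of unit productions and
  left-recursive predictions lengthen a path without reading input. That is why truncation counts
  states rather than scanned symbols, and why a measure on positions alone cannot prove finiteness.
  Such a measure still does most of the work. Without null productions every symbol before the dot
  covers at least one position, so a completion behind a nonempty prefix splits the span
  \<open>i - k\<close> of an inner state into two strictly shorter spans. Within one span, the only
  circular dependence between complete states runs through right-hand sides consisting of one
  nonterminal, and its matrix is \<open>P_U\<close>. Likewise a state with a nonempty prefix takes
  its forward sum from smaller positions, so at a fixed position only the predicted states depend on
  each other, with matrix \<open>P_L\<close>. Finiteness of the inner sums comes first, because
  completion multiplies forward sums by inner ones.\<close>

lemma matrix_pow_0: "matrix_pow A 0 = mat 1"
  and matrix_pow_Suc: "matrix_pow A (Suc n) = A ** matrix_pow A n"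
  by (simp_all add: matrix_pow_def)

lemma matrix_pow_Suc_right: "matrix_pow A (Suc n) = matrix_pow A n ** A"
  by (induction n) (simp_all add: matrix_pow_0 matrix_pow_Suc matrix_mul_assoc)

lemma matrix_pow_add: "matrix_pow A (m + n) = matrix_pow A m ** matrix_pow A n"
  by (induction m) (simp_all add: matrix_pow_0 matrix_pow_Suc matrix_mul_assoc)

lemma matrix_pow_nonneg:
  assumes "\<And>X Y. 0 \<le> A $ X $ Y"
  shows "0 \<le> matrix_pow A n $ X $ Y"
  by (induction n arbitrary: X Y)
    (auto simp: matrix_pow_0 matrix_pow_Suc mat_def matrix_matrix_mult_def intro!: sum_nonneg
        mult_nonneg_nonneg assms)

lemma matrix_pow_mono:
  assumes "\<And>X Y. 0 \<le> A $ X $ Y" "\<And>X Y. A $ X $ Y \<le> B $ X $ Y"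
  shows "matrix_pow A n $ X $ Y \<le> matrix_pow B n $ X $ Y"
proof (induction n arbitrary: X Y)
  case (Suc n)
  show ?case
    unfolding matrix_pow_Suc matrix_matrix_mult_def vec_lambda_beta
    by (intro sum_mono mult_mono Suc assms matrix_pow_nonneg order.trans[OF assms])
qed (simp add: matrix_pow_0)

lemma summable_matrix_pow_iff:
  "summable (matrix_pow A) \<longleftrightarrow> (\<forall>X Y. summable (\<lambda>n. matrix_pow A n $ X $ Y))" (is "?l \<longleftrightarrow> ?r")
proof
  assume l: ?l
  show ?r
    using bounded_linear.summable[OF bounded_linear_vec_nth, OF bounded_linear.summable[OF
        bounded_linear_vec_nth, OF l]] by simp
next
  assume r: ?r
  have "matrix_pow A sums (\<chi> X Y. \<Sum>n. matrix_pow A n $ X $ Y)"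
    unfolding sums_def
    by (intro vec_tendstoI) (simp add: r summable_LIMSEQ)
  then show ?l by (rule sums_summable)
qed

lemma suminf_matrix_pow:
  assumes "summable (matrix_pow A)"
  shows "(\<lambda>n. matrix_pow A n $ X $ Y) sums (suminf (matrix_pow A) $ X $ Y)"
  using bounded_linear.sums[OF bounded_linear_vec_nth, OF bounded_linear.sums[OF bounded_linear_vec_nth,
      OF summable_sums[OF assms]]] .

lemma suminf_matrix_pow_nonneg:
  assumes "summable (matrix_pow A)" "\<And>X Y. 0 \<le> A $ X $ Y"
  shows "0 \<le> suminf (matrix_pow A) $ X $ Y"
  using sums_le[OF matrix_pow_nonneg[OF assms(2)] sums_zero suminf_matrix_pow[OF assms(1)]] .

text \<open>Peels off the first or the last factor of each power. The version
  \<open>R = I + A R\<close> drives the uniform upper bound, \<open>R = I + R A\<close> the solution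
  of the fixed point equation.\<close>

lemma suminf_matrix_pow_unfold:
  assumes "summable (matrix_pow A)"
  shows "suminf (matrix_pow A) $ X $ Y = (if X = Y then 1 else 0) + (\<Sum>Z\<in>UNIV. A $ X $ Z * suminf
      (matrix_pow A) $ Z $ Y)" (is ?th1)
    and "suminf (matrix_pow A) $ X $ Y = (if X = Y then 1 else 0) + (\<Sum>Z\<in>UNIV. suminf (matrix_pow A) $ X
        $ Z * A $ Z $ Y)" (is ?th2)
proof -
  have *: "(\<lambda>n. matrix_pow A (Suc n) $ X $ Y) sums (suminf (matrix_pow A) $ X $ Y - matrix_pow A 0 $ X $ Y)"
    using suminf_matrix_pow[OF assms] by (subst sums_Suc_iff) simp
  have "(\<lambda>n. matrix_pow A (Suc n) $ X $ Y) sums (\<Sum>Z\<in>UNIV. A $ X $ Z * suminf (matrix_pow A) $ Z $ Y)"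
    unfolding matrix_pow_Suc matrix_matrix_mult_def vec_lambda_beta
    by (intro sums_sum sums_mult suminf_matrix_pow assms)
  from sums_unique2[OF * this] show ?th1 by (simp add: matrix_pow_0 mat_def)
  have "(\<lambda>n. matrix_pow A (Suc n) $ X $ Y) sums (\<Sum>Z\<in>UNIV. suminf (matrix_pow A) $ X $ Z * A $ Z $ Y)"
    unfolding matrix_pow_Suc_right matrix_matrix_mult_def vec_lambda_beta
    by (intro sums_sum sums_mult2 suminf_matrix_pow assms)
  from sums_unique2[OF * this] show ?th2 by (simp add: matrix_pow_0 mat_def)
qed

lemma summable_matrix_pow_mono:
  assumes "summable (matrix_pow B)" "\<And>X Y. 0 \<le> A $ X $ Y" "\<And>X Y. A $ X $ Y \<le> B $ X $ Y"
  shows "summable (matrix_pow A)"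
proof -
  have "summable (\<lambda>n. matrix_pow A n $ X $ Y)" for X Y
  proof (rule summable_comparison_test')
    show "summable (\<lambda>n. matrix_pow B n $ X $ Y)"
      using assms(1) summable_matrix_pow_iff by blast
    show "norm (matrix_pow A n $ X $ Y) \<le> matrix_pow B n $ X $ Y" if "n \<ge> 0" for n
      using matrix_pow_mono[OF assms(2,3)] matrix_pow_nonneg[OF assms(2)] by (simp add: abs_of_nonneg)
  qed
  then show ?thesis using summable_matrix_pow_iff by blast
qed

text \<open>Multiply \<open>h = g - A g\<close> from the left by the series \<open>R\<close> and use
  \<open>R - R A = I\<close>. Since \<open>g\<close> is real-valued, this identifies a sum of path
  probabilities only after its finiteness is known.\<close>

lemma suminf_matrix_pow_solve_left:
  fixes A :: "real ^ 'n ^ 'n"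
  assumes "summable (matrix_pow A)" "\<And>X. g X = h X + (\<Sum>Y\<in>UNIV. A $ X $ Y * g Y)"
  shows "g X = (\<Sum>Y\<in>UNIV. suminf (matrix_pow A) $ X $ Y * h Y)"
proof -
  let ?R = "suminf (matrix_pow A)"
  have h: "h Y = g Y - (\<Sum>Z\<in>UNIV. A $ Y $ Z * g Z)" for Y
    using assms(2)[of Y] by linarith
  have R: "?R $ X $ Z - (\<Sum>Y\<in>UNIV. ?R $ X $ Y * A $ Y $ Z) = (if X = Z then 1 else 0)" for Z
    using suminf_matrix_pow_unfold(2)[OF assms(1), of X Z] by linarith
  have "(\<Sum>Y\<in>UNIV. ?R $ X $ Y * h Y) = (\<Sum>Y\<in>UNIV. ?R $ X $ Y * (g Y - (\<Sum>Z\<in>UNIV. A $ Y $ Z * g Z)))"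
    by (simp only: h)
  also have "\<dots> = (\<Sum>Y\<in>UNIV. ?R $ X $ Y * g Y) - (\<Sum>Y\<in>UNIV. \<Sum>Z\<in>UNIV. ?R $ X $ Y * A $ Y $ Z * g Z)"
    by (simp add: right_diff_distrib sum_subtractf sum_distrib_left mult.assoc)
  also have "(\<Sum>Y\<in>UNIV. \<Sum>Z\<in>UNIV. ?R $ X $ Y * A $ Y $ Z * g Z) = (\<Sum>Z\<in>UNIV. (\<Sum>Y\<in>UNIV. ?R $ X $ Y * A $ Y $
      Z) * g Z)"
    by (subst sum.swap) (simp add: sum_distrib_right)
  also have "(\<Sum>Y\<in>UNIV. ?R $ X $ Y * g Y) - \<dots> = (\<Sum>Z\<in>UNIV. (?R $ X $ Z - (\<Sum>Y\<in>UNIV. ?R $ X $ Y * A $ Y $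
      Z)) * g Z)"
    by (simp add: sum_subtractf left_diff_distrib)
  also have "\<dots> = (\<Sum>Z\<in>UNIV. (if X = Z then 1 else 0) * g Z)"
    by (simp only: R)
  also have "\<dots> = g X" by (simp add: if_distrib[of "\<lambda>x. x * _"] cong: if_cong)
  finally show ?thesis by simp
qed

text \<open>Transposition turns \<open>a = b + a P_L\<close>, an equation for row vectors, into the
  column form that the solving and bounding lemmas treat.\<close>

lemma matrix_pow_transpose: "matrix_pow (transpose A) n = transpose (matrix_pow A n)"
  by (induction n) (simp_all add: matrix_pow_0 matrix_pow_Suc_right[of A] matrix_pow_Suc[of "transpose A"]
      matrix_transpose_mul transpose_mat)

lemma
  fixes A :: "real ^ 'n ^ 'n"
  assumes "summable (matrix_pow A)"
  shows summable_matrix_pow_transpose: "summable (matrix_pow (transpose A))"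
    and suminf_matrix_pow_transpose: "suminf (matrix_pow (transpose A)) = transpose (suminf (matrix_pow A))"
proof -
  show *: "summable (matrix_pow (transpose A))"
    using assms unfolding summable_matrix_pow_iff matrix_pow_transpose by (simp add: transpose_def)
  show "suminf (matrix_pow (transpose A)) = transpose (suminf (matrix_pow A))"
  proof (intro vec_eq_iff[THEN iffD2] allI)
    fix X Y
    have "(\<lambda>n. matrix_pow (transpose A) n $ X $ Y) sums (suminf (matrix_pow A) $ Y $ X)"
      unfolding matrix_pow_transpose using suminf_matrix_pow[OF assms] by (simp add: transpose_def)
    from sums_unique2[OF suminf_matrix_pow[OF *] this]
    show "suminf (matrix_pow (transpose A)) $ X $ Y = transpose (suminf (matrix_pow A)) $ X $ Y"
      by (simp add: transpose_def)
  qed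
qed

text \<open>Bounds sums that are not yet known to be finite, for which the fixed point equation alone would
  not exclude the value \<open>\<infinity>\<close>.\<close>

lemma bounded_by_suminf_matrix_pow:
  fixes A :: "real ^ 'n ^ 'n" and u :: "nat \<Rightarrow> 'n \<Rightarrow> ennreal" and h :: "'n \<Rightarrow> real"
  assumes "summable (matrix_pow A)" "\<And>X Y. 0 \<le> A $ X $ Y" "\<And>X. 0 \<le> h X"
    and "\<And>X. u 0 X = 0"
    and "\<And>N X. u (Suc N) X \<le> ennreal (h X) + (\<Sum>Y\<in>UNIV. ennreal (A $ X $ Y) * u N Y)"
  shows "u N X \<le> ennreal (\<Sum>Y\<in>UNIV. suminf (matrix_pow A) $ X $ Y * h Y)"
proof (induction N arbitrary: X)
  case (Suc N)
  let ?R = "suminf (matrix_pow A)"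
  have nn: "0 \<le> (\<Sum>Z\<in>UNIV. ?R $ Y $ Z * h Z)" for Y
    by (intro sum_nonneg mult_nonneg_nonneg suminf_matrix_pow_nonneg assms)
  have "u (Suc N) X \<le> ennreal (h X) + (\<Sum>Y\<in>UNIV. ennreal (A $ X $ Y) * u N Y)" by fact
  also have "\<dots> \<le> ennreal (h X) + (\<Sum>Y\<in>UNIV. ennreal (A $ X $ Y) * ennreal (\<Sum>Z\<in>UNIV. ?R $ Y $ Z * h Z))"
    by (intro add_left_mono sum_mono mult_left_mono Suc) simp
  also have "\<dots> = ennreal (h X + (\<Sum>Y\<in>UNIV. A $ X $ Y * (\<Sum>Z\<in>UNIV. ?R $ Y $ Z * h Z)))"
    using assms nn by (simp add: sum_nonneg flip: ennreal_mult ennreal_plus)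
  also have "(\<Sum>Y\<in>UNIV. A $ X $ Y * (\<Sum>Z\<in>UNIV. ?R $ Y $ Z * h Z)) = (\<Sum>Z\<in>UNIV. (\<Sum>Y\<in>UNIV. A $ X $ Y * ?R $ Y
      $ Z) * h Z)"
    by (simp add: sum_distrib_left sum_distrib_right mult.assoc) (rule sum.swap)
  also have "h X = (\<Sum>Z\<in>UNIV. (if X = Z then 1 else 0) * h Z)"
    by (simp add: if_distrib[of "\<lambda>x. x * _"] cong: if_cong)
  also have "\<dots> + (\<Sum>Z\<in>UNIV. (\<Sum>Y\<in>UNIV. A $ X $ Y * ?R $ Y $ Z) * h Z) = (\<Sum>Z\<in>UNIV. ?R $ X $ Z * h Z)"
    by (subst suminf_matrix_pow_unfold(1)[OF assms(1)]) (simp add: distrib_right sum.distrib)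
  finally show ?case .
qed (simp add: assms)

section \<open>Convergence of the left-corner and unit-production series\<close>

text \<open>Rewriting a member of \<open>C\<close> produces another one, and rewriting any other
  nonterminal leaves the occurrence of \<open>X\<close> in place. A nonzero derivation probability
  ensures that only productions of nonzero probability are applied.\<close>

lemma derivation_trapped:
  assumes C: "\<And>X \<nu>. X \<in> C \<Longrightarrow> (X, \<nu>) \<in> prods G \<Longrightarrow> prob G (X, \<nu>) \<noteq> 0 \<Longrightarrow> \<exists>Y\<in>C. NT Y \<in> set \<nu>"
    and "derivation G w ps w'" "derivation_prob G ps \<noteq> 0" "X \<in> C" "NT X \<in> set w"
  shows "\<exists>Y\<in>C. NT Y \<in> set w'"
  using assms(2-)
proof (induction arbitrary: X)
  case (step Z \<nu> u v ps w)
  have p: "derivation_prob G ps \<noteq> 0" "prob G (Z, \<nu>) \<noteq> 0"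
    using step.prems(1) by (auto simp: derivation_prob_def)
  show ?case
  proof (cases "Z \<in> C")
    case True
    then obtain Y where "Y \<in> C" "NT Y \<in> set \<nu>" using C step.hyps(1) p(2) by blast
    then show ?thesis using step.IH[OF p(1), of Y] by simp
  next
    case False
    then have "NT X \<in> set (u @ \<nu> @ v)" using step.prems by auto
    then show ?thesis using step.IH[OF p(1)] step.prems by blast
  qed
qed auto

lemma finite_rhs: "is_scfg G \<Longrightarrow> finite {\<nu>. (X, \<nu>) \<in> prods G}"
  by (rule finite_subset[of _ "snd ` prods G"]) (force simp: is_scfg_def)+

lemma prob_nonneg: "is_scfg G \<Longrightarrow> r \<in> prods G \<Longrightarrow> 0 \<le> prob G r"
  by (simp add: is_scfg_def)

lemma inj_NT_Cons: "inj_on (\<lambda>\<nu>. NT Y # \<nu>) A"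
  by (simp add: inj_on_def)

lemma finite_left_corner: "is_scfg G \<Longrightarrow> finite {\<nu>. (X, NT Y # \<nu>) \<in> prods G}"
  using finite_vimageI[OF finite_rhs inj_NT_Cons] by (simp add: vimage_def)

lemma left_corner_matrix_nonneg: "is_scfg G \<Longrightarrow> 0 \<le> left_corner_matrix G $ X $ Y"
  by (auto simp: left_corner_matrix_def intro!: sum_nonneg prob_nonneg)

lemma unit_matrix_nonneg: "is_scfg G \<Longrightarrow> 0 \<le> unit_matrix G $ X $ Y"
  by (auto simp: unit_matrix_def intro!: prob_nonneg)

lemma unit_le_left_corner: "is_scfg G \<Longrightarrow> unit_matrix G $ X $ Y \<le> left_corner_matrix G $ X $ Y"
  using member_le_sum[of "[]" "{\<nu>. (X, NT Y # \<nu>) \<in> prods G}" "\<lambda>\<nu>. prob G (X, NT Y # \<nu>)"]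
    left_corner_matrix_nonneg[of G X Y]
  by (auto simp: unit_matrix_def left_corner_matrix_def finite_left_corner prob_nonneg)

text \<open>The first symbol of a right-hand side determines \<open>Y\<close>, so the sum over
  \<open>Y\<close> merely regroups productions. In a proper grammar this row sum falls short of 1 by
  the total probability of the other right-hand sides.\<close>

lemma left_corner_row_sum:
  fixes G :: "('n::finite, 't::finite) scfg"
  assumes "is_scfg G"
  shows "(\<Sum>Y\<in>UNIV. left_corner_matrix G $ X $ Y) = (\<Sum>\<nu> | (X, \<nu>) \<in> prods G \<and> (\<exists>Y \<nu>'. \<nu> = NT Y # \<nu>'). prob
      G (X, \<nu>))"
proof -
  have "(\<Sum>Y\<in>UNIV. left_corner_matrix G $ X $ Y) = (\<Sum>(Y, \<nu>)\<in>(SIGMA Y:UNIV. {\<nu>. (X, NT Y # \<nu>) \<in> prods G}).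
      prob G (X, NT Y # \<nu>))"
    using assms by (simp add: left_corner_matrix_def sum.Sigma finite_left_corner)
  also have "\<dots> = (\<Sum>\<nu> | (X, \<nu>) \<in> prods G \<and> (\<exists>Y \<nu>'. \<nu> = NT Y # \<nu>'). prob G (X, \<nu>))"
    by (rule sum.reindex_bij_witness[of _ "\<lambda>\<nu>. (case hd \<nu> of NT Y \<Rightarrow> Y, tl \<nu>)" "\<lambda>(Y, \<nu>). NT Y # \<nu>"]) auto
  finally show ?thesis .
qed

text \<open>The row sum \<open>r n X\<close> of the \<open>n\<close>-th power is the total weight of
  left-corner chains of \<open>n\<close> steps from \<open>X\<close>; it is at most 1 and decreases
  in \<open>n\<close>. Once every \<open>X\<close> loses mass eventually, there are a common
  \<open>N\<close> and \<open>c < 1\<close> with \<open>r N X \<le> c\<close> for all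
  \<open>X\<close>. Every \<open>N\<close> steps then shrink the row sum by the factor
  \<open>c\<close>, so the row sums are summable and dominate the entries.\<close>

proposition summable_left_corner:
  fixes G :: "('n::finite, 't::finite) scfg"
  assumes G: "is_scfg G" "proper G" "no_useless_nonterminals G"
  shows "summable (matrix_pow (left_corner_matrix G))"
proof -
  define P where "P = left_corner_matrix G"
  define r where "r n X = (\<Sum>Y\<in>UNIV. matrix_pow P n $ X $ Y)" for n X
  have P0: "0 \<le> P $ X $ Y" for X Y using G by (simp add: P_def left_corner_matrix_nonneg)
  note M0 = matrix_pow_nonneg[of P, OF P0]
  have row: "(\<Sum>Y\<in>UNIV. P $ X $ Y) = 1 - (\<Sum>\<nu> | (X, \<nu>) \<in> prods G \<and> \<not> (\<exists>Y \<nu>'. \<nu> = NT Y # \<nu>'). prob G (X,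
      \<nu>))" for X
  proof -
    have "1 = (\<Sum>\<nu> | (X, \<nu>) \<in> prods G. prob G (X, \<nu>))" using G by (simp add: proper_def)
    also have "\<dots> = (\<Sum>\<nu> | (X, \<nu>) \<in> prods G \<and> (\<exists>Y \<nu>'. \<nu> = NT Y # \<nu>'). prob G (X, \<nu>)) + (\<Sum>\<nu> | (X, \<nu>) \<in>
        prods G \<and> \<not> (\<exists>Y \<nu>'. \<nu> = NT Y # \<nu>'). prob G (X, \<nu>))"
      using finite_rhs[OF G(1), of X]
      by (subst sum.union_disjoint[symmetric]) (auto intro!: sum.cong elim: rev_finite_subset)
    finally show ?thesis unfolding P_def left_corner_row_sum[OF G(1)] by simp
  qed
  have row1: "(\<Sum>Y\<in>UNIV. P $ X $ Y) \<le> 1" for X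
    unfolding row by (auto intro!: sum_nonneg prob_nonneg G)
  have r_add: "r (m + n) X = (\<Sum>Z\<in>UNIV. matrix_pow P m $ X $ Z * r n Z)" for m n X
    unfolding r_def matrix_pow_add matrix_matrix_mult_def vec_lambda_beta sum_distrib_left by (rule sum.swap)
  have r_Suc: "r (Suc n) X = (\<Sum>Z\<in>UNIV. P $ X $ Z * r n Z)" for n X
    unfolding r_def matrix_pow_Suc matrix_matrix_mult_def vec_lambda_beta sum_distrib_left by (rule sum.swap)
  have r0: "0 \<le> r n X" for n X by (auto simp: r_def intro!: sum_nonneg M0)
  have r_le1: "r n X \<le> 1" for n X
  proof (induction n arbitrary: X)
    case 0 show ?case by (simp add: r_def matrix_pow_0 mat_def)
  next
    case (Suc n)
    have "r (Suc n) X \<le> (\<Sum>Z\<in>UNIV. P $ X $ Z * 1)"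
      unfolding r_Suc by (intro sum_mono mult_left_mono Suc P0)
    then show ?case using row1[of X] by simp
  qed
  have r_dec: "r (Suc n) X \<le> r n X" for n X
  proof -
    have "r (n + 1) X \<le> (\<Sum>Z\<in>UNIV. matrix_pow P n $ X $ Z * 1)"
      unfolding r_add by (intro sum_mono mult_left_mono r_le1 M0)
    then show ?thesis by (simp add: r_def)
  qed
  have r_anti: "m \<le> n \<Longrightarrow> r n X \<le> r m X" for m n X
    by (rule lift_Suc_antimono_le[of "\<lambda>n. r n X"]) (rule r_dec)
  \<comment> \<open>From a nonterminal in \<open>C\<close> every production of positive probability starts with a nonterminal
    in \<open>C\<close>, so no terminal string is derivable.\<close>
  define C where "C = {X. \<forall>n. r n X = 1}"
  have closed: "\<exists>Y\<in>C. NT Y \<in> set \<nu>" if "X \<in> C" and \<nu>: "(X, \<nu>) \<in> prods G" "prob G (X, \<nu>) \<noteq> 0" for X \<nu>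
  proof -
    have one: "(\<Sum>Z\<in>UNIV. P $ X $ Z * r n Z) = 1" for n
      using \<open>X \<in> C\<close> by (auto simp: C_def simp flip: r_Suc)
    have "(\<Sum>Z\<in>UNIV. P $ X $ Z * r n Z) \<le> (\<Sum>Z\<in>UNIV. P $ X $ Z)" for n
      by (intro sum_mono mult_left_le r_le1 P0)
    with one row1[of X] have rs: "(\<Sum>Z\<in>UNIV. P $ X $ Z) = 1" by (metis order.antisym)
    \<comment> \<open>No mass is lost in the first step or later, so these nonnegative defects
      vanish termwise: every \<open>Z\<close> with a positive entry has \<open>r n Z = 1\<close> for
      all \<open>n\<close> and lies in \<open>C\<close>.\<close>
    have "(\<Sum>Z\<in>UNIV. P $ X $ Z * (1 - r n Z)) = 0" for n
      using one[of n] rs by (simp add: right_diff_distrib sum_subtractf)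
    then have z: "P $ X $ Z * (1 - r n Z) = 0" for n Z
      by (subst (asm) sum_nonneg_eq_0_iff) (auto intro!: mult_nonneg_nonneg P0 r_le1)
    have "(\<Sum>\<nu> | (X, \<nu>) \<in> prods G \<and> \<not> (\<exists>Y \<nu>'. \<nu> = NT Y # \<nu>'). prob G (X, \<nu>)) = 0"
      using rs row by simp
    moreover have "finite {\<nu>. (X, \<nu>) \<in> prods G \<and> \<not> (\<exists>Y \<nu>'. \<nu> = NT Y # \<nu>')}"
      using finite_rhs[OF G(1), of X] by (auto elim: rev_finite_subset)
    ultimately have "\<exists>Y \<nu>'. \<nu> = NT Y # \<nu>'"
      using \<nu> by (subst (asm) sum_nonneg_eq_0_iff) (auto intro: prob_nonneg[OF G(1)])
    then obtain Y \<nu>' where Y: "\<nu> = NT Y # \<nu>'" by blast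
    have "0 < prob G (X, \<nu>)" using prob_nonneg[OF G(1) \<nu>(1)] \<nu>(2) by linarith
    also have "\<dots> \<le> P $ X $ Y"
      unfolding P_def left_corner_matrix_def vec_lambda_beta Y using \<nu>(1) Y
      by (intro member_le_sum[of \<nu>' _ "\<lambda>\<nu>. prob G (X, NT Y # \<nu>)"]) (auto intro: prob_nonneg
          finite_left_corner G)
    finally have "Y \<in> C" using z[of Y] by (auto simp: C_def)
    then show ?thesis using Y by auto
  qed
  have "X \<notin> C" for X
  proof
    assume "X \<in> C"
    obtain u v ps qs x where d: "derivation G (u @ NT X # v) qs (map Tm x)" "derivation_prob G (ps @ qs) \<noteq> 0"
      using G(3) unfolding no_useless_nonterminals_def by blast
    have "derivation_prob G qs \<noteq> 0" using d(2) by (auto simp: derivation_prob_def)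
    have "\<exists>Y\<in>C. NT Y \<in> set (map Tm x)"
      by (rule derivation_trapped[OF _ d(1) \<open>derivation_prob G qs \<noteq> 0\<close> \<open>X \<in> C\<close>]) (use closed in auto)
    then show False by auto
  qed
  then have "\<forall>X. \<exists>n. r n X \<noteq> 1" by (auto simp: C_def)
  then obtain n where n: "\<And>X. r (n X) X \<noteq> 1" by metis
  \<comment> \<open>There are finitely many nonterminals and \<open>r\<close> decreases in its first
    argument, so the largest of the individual witnesses serves all of them.\<close>
  define N where "N = Max (range n)"
  have less: "r N X < 1" for X
    using r_anti[of "n X" N X] n[of X] r_le1[of "n X" X] by (auto simp: N_def)
  define c where "c = Max (range (r N))"
  have c: "r N X \<le> c" for X by (auto simp: c_def)
  have "c \<in> range (r N)" unfolding c_def by (intro Max_in) auto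
  with less have c1: "c < 1" by auto
  have shrink: "r (n + N) X \<le> c * r n X" for n X
  proof -
    have "r (n + N) X \<le> (\<Sum>Z\<in>UNIV. matrix_pow P n $ X $ Z * c)"
      unfolding r_add by (intro sum_mono mult_left_mono c M0)
    then show ?thesis by (simp add: r_def sum_distrib_left mult.commute)
  qed
  \<comment> \<open>\<open>(1 - c) * r n X \<le> r n X - r (n + N) X\<close>, and the right-hand side telescopes.\<close>
  have bound: "(\<Sum>n<M. r n X) \<le> N / (1 - c)" for M X
  proof -
    have "(1 - c) * (\<Sum>n<M. r n X) \<le> (\<Sum>n<M. r n X - r (n + N) X)"
      unfolding sum_distrib_left by (intro sum_mono) (use shrink in \<open>simp add: algebra_simps\<close>)
    also have "\<dots> = (\<Sum>n<M. r n X) - (\<Sum>n\<in>{N..<M + N}. r n X)"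
      using sum.shift_bounds_nat_ivl[of "\<lambda>n. r n X" 0 N M] by (simp add: sum_subtractf atLeast0LessThan)
    also have "\<dots> \<le> (\<Sum>n<M + N. r n X) - (\<Sum>n\<in>{N..<M + N}. r n X)"
      using r0 by (intro diff_right_mono sum_mono2) auto
    also have "\<dots> = (\<Sum>n<N. r n X)"
      using sum.atLeastLessThan_concat[of 0 N "M + N" "\<lambda>n. r n X"] by (simp add: atLeast0LessThan)
    also have "\<dots> \<le> N" using sum_bounded_above[of "{..<N}" "\<lambda>n. r n X" 1] r_le1 by simp
    finally show ?thesis using c1 by (simp add: field_simps)
  qed
  have "summable (\<lambda>n. matrix_pow P n $ X $ Y)" for X Y
  proof (rule summable_comparison_test')
    show "summable (\<lambda>n. r n X)"
      by (rule bounded_imp_summable[of _ "N / (1 - c)"]) (use r0 bound[where M = "Suc _"] in \<open>auto simp: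
          lessThan_Suc_atMost\<close>)
    show "norm (matrix_pow P n $ X $ Y) \<le> r n X" if "n \<ge> 0" for n
      using member_le_sum[of Y UNIV "\<lambda>Y. matrix_pow P n $ X $ Y"] M0 by (simp add: r_def abs_of_nonneg)
  qed
  then show ?thesis by (simp add: summable_matrix_pow_iff P_def)
qed

lemma summable_unit:
  fixes G :: "('n::finite, 't::finite) scfg"
  assumes G: "is_scfg G" "proper G" "no_useless_nonterminals G"
  shows "summable (matrix_pow (unit_matrix G))"
  by (rule summable_matrix_pow_mono[OF summable_left_corner[OF assms] unit_matrix_nonneg[OF G(1)]
      unit_le_left_corner[OF G(1)]])

section \<open>Paths and their decomposition\<close>

text \<open>Paths grow at the right end, so rule induction and case analysis act on the last step.
  The first state is an arbitrary parameter; \<open>start_state\<close> is imposed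
  separately.\<close>

inductive earley_path :: "('n, 't) scfg \<Rightarrow> ('n, 't) state \<Rightarrow> ('n, 't) path \<Rightarrow> bool" for G h where
  start: "earley_path G h [(h, 0)]"
| predict: "earley_path G h p \<Longrightarrow> last p = (State i k X \<beta> (NT Y # \<mu>), r) \<Longrightarrow> (Y, \<nu>) \<in> prods G
    \<Longrightarrow> earley_path G h (p @ [(State i i (Some Y) [] \<nu>, length p)])"
| scan: "earley_path G h p \<Longrightarrow> last p = (State i k X \<beta> (Tm a # \<mu>), r)
    \<Longrightarrow> earley_path G h (p @ [(State (Suc i) k X (\<beta> @ [Tm a]) \<mu>, r)])"
| complete: "earley_path G h p \<Longrightarrow> last p = (State i j (Some Y) \<nu> [], r) \<Longrightarrow> 0 < r
    \<Longrightarrow> p ! (r - 1) = (State j k X \<beta> (NT Y # \<mu>), r')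
    \<Longrightarrow> earley_path G h (p @ [(State i k X (\<beta> @ [NT Y]) \<mu>, r')])"

lemma path_not_Nil: "earley_path G h p \<Longrightarrow> p \<noteq> []"
  by (induction rule: earley_path.induct) auto

lemma path_hd: "earley_path G h p \<Longrightarrow> hd p = (h, 0)"
  by (induction rule: earley_path.induct) (auto simp: path_not_Nil)

lemma last_in_path: "earley_path G h p \<Longrightarrow> last p = c \<Longrightarrow> c \<in> set p"
  using path_not_Nil by fastforce

lemma path_root_less: "earley_path G h p \<Longrightarrow> (s, r) \<in> set p \<Longrightarrow> r < length p"
proof (induction arbitrary: s r rule: earley_path.induct)
  case (complete p i j Y \<nu> r1 k X \<beta> \<mu> r')
  have "r1 < length p"
    using complete.IH last_in_path[OF complete.hyps(1,2)] by blast
  then have "(State j k X \<beta> (NT Y # \<mu>), r') \<in> set p"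
    by (metis nth_mem less_imp_diff_less complete.hyps(4))
  then show ?case using complete.IH complete.prems by (fastforce intro: less_SucI)
next
  case (scan p i k X \<beta> a \<mu> r')
  then show ?case using last_in_path[OF scan.hyps(1,2)] by (fastforce intro: less_SucI)
qed (fastforce intro: less_SucI)+

lemma path_last_root_less: "earley_path G h p \<Longrightarrow> last p = (s, r) \<Longrightarrow> r < length p"
  using path_root_less last_in_path by blast

section \<open>Agreement of the indexed and the inductive notion of path\<close>

definition is_step :: "('n, 't) scfg \<Rightarrow> ('n, 't) path \<Rightarrow> nat \<Rightarrow> bool" where
  "is_step G p t \<longleftrightarrow> prediction_step G p t \<or> scanning_step p t \<or> completion_step p t"

definition start_state :: "('n, 't) scfg \<Rightarrow> ('n, 't) state \<Rightarrow> bool" where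
  "start_state G h \<longleftrightarrow> h = initial_state G \<or> is_predicted G h"

lemma is_path_iff_steps:
  "is_path G p \<longleftrightarrow> p \<noteq> [] \<and> start_state G (fst (hd p)) \<and> snd (hd p) = 0 \<and> (\<forall>t. Suc t < length p \<longrightarrow> is_step
      G p t)"
  by (auto simp: is_path_def is_step_def start_state_def)

text \<open>Completion jumps back to the root index, hence the strong induction. By this bound the
  step out of position \<open>t\<close> looks at nothing beyond position \<open>t + 1\<close>, so
  appending entries does not affect it.\<close>

lemma is_path_root_le: "is_path G p \<Longrightarrow> t < length p \<Longrightarrow> snd (p ! t) \<le> t"
proof (induction t rule: less_induct)
  case (less t)
  show ?case
  proof (cases t)
    case 0
    then show ?thesis using less.prems by (auto simp: is_path_def hd_conv_nth)
  next
    case (Suc u)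
    have u: "snd (p ! u) \<le> u" using less Suc by simp
    have "snd (p ! (snd (p ! u) - 1)) \<le> snd (p ! u) - 1"
      using u Suc less.prems by (intro less.IH) auto
    moreover have "is_step G p u" using less.prems Suc by (simp add: is_path_iff_steps)
    ultimately show ?thesis using u Suc
      unfolding is_step_def prediction_step_def scanning_step_def completion_step_def by auto
  qed
qed

lemma is_step_snoc:
  assumes "Suc t < length p" "snd (p ! t) \<le> t"
  shows "is_step G (p @ [c]) t \<longleftrightarrow> is_step G p t"
proof -
  have "(p @ [c]) ! t = p ! t" "(p @ [c]) ! Suc t = p ! Suc t" "(p @ [c]) ! (snd (p ! t) - 1) = p ! (snd
      (p ! t) - 1)"
    using assms by (auto simp: nth_append)
  then show ?thesis
    unfolding is_step_def prediction_step_def scanning_step_def completion_step_def by simp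
qed

lemma is_path_snoc:
  assumes "p \<noteq> []"
  shows "is_path G (p @ [c]) \<longleftrightarrow> is_path G p \<and> is_step G (p @ [c]) (length p - 1)"
proof
  assume l: "is_path G (p @ [c])"
  have "is_step G p t" if t: "Suc t < length p" for t
  proof -
    have "snd (p ! t) \<le> t" using is_path_root_le[OF l, of t] t by (simp add: nth_append)
    then show ?thesis using l t is_step_snoc[of t p G c] by (simp add: is_path_iff_steps)
  qed
  then show "is_path G p \<and> is_step G (p @ [c]) (length p - 1)"
    using l assms by (simp add: is_path_iff_steps)
next
  assume r: "is_path G p \<and> is_step G (p @ [c]) (length p - 1)"
  have "is_step G (p @ [c]) t" if t: "Suc t < Suc (length p)" for t
  proof (cases "Suc t < length p")
    case True
    have "snd (p ! t) \<le> t" using is_path_root_le[of G p t] r t by simp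
    then show ?thesis using r True is_step_snoc[of t p G c] by (simp add: is_path_iff_steps)
  next
    case False
    then have "t = length p - 1" using t by simp
    then show ?thesis using r by simp
  qed
  then show "is_path G (p @ [c])" using r assms by (simp add: is_path_iff_steps)
qed

lemma is_path_snoc_cases:
  assumes p: "is_path G p"
  shows "is_step G (p @ [c]) (length p - 1) \<longleftrightarrow>
    (\<exists>i k X \<beta> Y \<mu> \<nu> r. last p = (State i k X \<beta> (NT Y # \<mu>), r) \<and> (Y, \<nu>) \<in> prods G \<and>
        c = (State i i (Some Y) [] \<nu>, length p)) \<or>
    (\<exists>i k X \<beta> a \<mu> r. last p = (State i k X \<beta> (Tm a # \<mu>), r) \<and>
        c = (State (Suc i) k X (\<beta> @ [Tm a]) \<mu>, r)) \<or>
    (\<exists>i j k X \<beta> Y \<mu> \<nu> r r'. last p = (State i j (Some Y) \<nu> [], r) \<and> 0 < r \<and>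
        p ! (r - 1) = (State j k X \<beta> (NT Y # \<mu>), r') \<and> c = (State i k X (\<beta> @ [NT Y]) \<mu>, r'))"
proof -
  have ne: "p \<noteq> []" using p by (simp add: is_path_def)
  obtain s r where l: "last p = (s, r)" by fastforce
  have "r \<le> length p - 1"
    using is_path_root_le[OF p, of "length p - 1"] ne l by (simp add: last_conv_nth)
  then have "r - 1 < length p"
    using ne by (cases p) auto
  then have 3: "(p @ [c]) ! (r - 1) = p ! (r - 1)"
    by (simp add: nth_append)
  have 1: "(p @ [c]) ! (length p - 1) = (s, r)" "(p @ [c]) ! Suc (length p - 1) = c" "Suc (length p - 1)
      = length p"
    using ne l by (auto simp: nth_append last_conv_nth)
  obtain s' r' where q: "p ! (r - Suc 0) = (s', r')" by fastforce
  show ?thesis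
    unfolding is_step_def prediction_step_def scanning_step_def completion_step_def 1 fst_conv snd_conv 3 l
    by (simp add: q)
qed

text \<open>Both directions append one entry at a time: earlier steps do not see the new entry, so
  the condition on all positions reduces to the one on the last step.\<close>

lemma is_path_iff_path: "is_path G p \<and> fst (hd p) = h \<longleftrightarrow> start_state G h \<and> earley_path G h p"
proof (intro iffI conjI)
  show "earley_path G h p" if "is_path G p \<and> fst (hd p) = h"
    using that
  proof (induction p rule: rev_induct)
    case Nil
    then show ?case by (simp add: is_path_def)
  next
    case (snoc c p)
    show ?case
    proof (cases "p = []")
      case True
      then have "c = (h, 0)" using snoc.prems by (cases c) (simp add: is_path_def)
      then show ?thesis using True by (simp add: earley_path.start)
    next
      case False
      then have p: "is_path G p" and s: "is_step G (p @ [c]) (length p - 1)" and q: "earley_path G h p"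
        using snoc by (auto simp: is_path_snoc)
      show ?thesis
        using s unfolding is_path_snoc_cases[OF p] by (auto intro: earley_path.intros(2-)[OF q])
    qed
  qed
  show "start_state G h" if "is_path G p \<and> fst (hd p) = h"
    using that by (auto simp: is_path_iff_steps)
next
  assume "start_state G h \<and> earley_path G h p"
  then have h: "start_state G h" and p: "earley_path G h p" by auto
  show "fst (hd p) = h" using path_hd[OF p] by simp
  from p show "is_path G p"
  proof induction
    case start
    show ?case using h by (simp add: is_path_iff_steps)
  next
    case (predict p i k X \<beta> Y \<mu> r \<nu>)
    then show ?case
      unfolding is_path_snoc[OF path_not_Nil[OF predict.hyps(1)]] is_path_snoc_cases[OF predict.IH] by auto
  next
    case (scan p i k X \<beta> a \<mu> r)
    then show ?case
      unfolding is_path_snoc[OF path_not_Nil[OF scan.hyps(1)]] is_path_snoc_cases[OF scan.IH] by auto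
  next
    case (complete p i j Y \<nu> r k X \<beta> \<mu> r')
    then show ?case
      unfolding is_path_snoc[OF path_not_Nil[OF complete.hyps(1)]] is_path_snoc_cases[OF complete.IH] by auto
  qed
qed

section \<open>Translating root indices and gluing paths\<close>

definition shift :: "nat \<Rightarrow> ('n, 't) path \<Rightarrow> ('n, 't) path" where
  "shift n p = map (\<lambda>(s, r). (s, r + n)) p"

lemma shift_shift [simp]: "shift m (shift n p) = shift (m + n) p"
  and shift_append [simp]: "shift n (p @ q) = shift n p @ shift n q"
  and length_shift [simp]: "length (shift n p) = length p"
  and shift_eq_Nil [simp]: "shift n p = [] \<longleftrightarrow> p = []"
  and shift_Nil [simp]: "shift n [] = []"
  and shift_Cons [simp]: "shift n ((s, r) # p) = (s, r + n) # shift n p"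
  by (auto simp: shift_def case_prod_beta algebra_simps)

lemma last_shift: "p \<noteq> [] \<Longrightarrow> last p = (s, r) \<Longrightarrow> last (shift n p) = (s, r + n)"
  by (simp add: shift_def last_map)

lemma nth_shift: "t < length p \<Longrightarrow> p ! t = (s, r) \<Longrightarrow> shift n p ! t = (s, r + n)"
  by (simp add: shift_def)

lemma inj_shift: "shift n p = shift n q \<longleftrightarrow> p = q"
  unfolding shift_def by (rule inj_map_eq_map) (auto simp: inj_on_def)

text \<open>Root indices are absolute list positions, so those of \<open>q\<close> move up by
  \<open>length p\<close>. The root index 0 of its first state becomes exactly the one that
  prediction assigns, and a completion in \<open>q\<close> has a positive root index, so its
  predictor lies inside \<open>q\<close> as well.\<close>

lemma path_append_shift:
  assumes "earley_path G h p" "last p = (State i k X \<beta> (NT Y # \<mu>), r)" "(Y, \<nu>) \<in> prods G"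
    and "earley_path G (State i i (Some Y) [] \<nu>) q"
  shows "earley_path G h (p @ shift (length p) q)"
  using assms(4)
proof induction
  case start
  show ?case using earley_path.predict[OF assms(1-3)] by simp
next
  case (predict q i k X \<beta> Y \<mu> r \<nu>)
  have "last (p @ shift (length p) q) = (State i k X \<beta> (NT Y # \<mu>), r + length p)"
    using path_not_Nil[OF predict.hyps(1)] last_shift predict.hyps(2) by auto
  from earley_path.predict[OF predict.IH this predict.hyps(3)] show ?case by (simp add: add.commute)
next
  case (scan q i k X \<beta> a \<mu> r)
  have "last (p @ shift (length p) q) = (State i k X \<beta> (Tm a # \<mu>), r + length p)"
    using path_not_Nil[OF scan.hyps(1)] last_shift scan.hyps(2) by auto
  from earley_path.scan[OF scan.IH this] show ?case by simp
next
  case (complete q i j Y \<nu> r k X \<beta> \<mu> r')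
  have l: "last (p @ shift (length p) q) = (State i j (Some Y) \<nu> [], r + length p)"
    using path_not_Nil[OF complete.hyps(1)] last_shift complete.hyps(2) by auto
  have "r + length p - 1 = length p + (r - 1)" using complete.hyps(3) by simp
  then have "(p @ shift (length p) q) ! (r + length p - 1) = (State j k X \<beta> (NT Y # \<mu>), r' + length p)"
    using nth_shift[OF _ complete.hyps(4)] path_last_root_less[OF complete.hyps(1,2)] by simp
  from earley_path.complete[OF complete.IH l _ this] show ?case using complete.hyps(3) by simp
qed

definition predicted_from :: "('n, 't) scfg \<Rightarrow> ('n, 't) path \<Rightarrow> ('n, 't) state \<Rightarrow> bool" where
  "predicted_from G p h' \<longleftrightarrow> (\<exists>i k X \<beta> Y \<mu> r \<nu>. last p = (State i k X \<beta> (NT Y # \<mu>), r) \<and> (Y, \<nu>) \<in> prods G \<and>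
     h' = State i i (Some Y) [] \<nu>)"

text \<open>Everything from the root index on is itself a path. In the completion case the two expansions,
  of the completed nonterminal and of the state that predicted it, are glued together by
  \<open>path_append_shift\<close>.\<close>

lemma path_decompose:
  assumes "earley_path G h p" "last p = (s, r)" "0 < r"
  shows "\<exists>p' q h'. length p' = r \<and> p = p' @ shift r q \<and> earley_path G h p' \<and> predicted_from G p' h' \<and>
     earley_path G h' q \<and> last q = (s, 0)"
  using assms
proof (induction "length p" arbitrary: p s r rule: less_induct)
  case less
  from less.prems show ?case
  proof (cases rule: earley_path.cases)
    case (predict p0 i k X \<beta> Y \<mu> r0 \<nu>)
    then have "predicted_from G p0 s" "r = length p0"
      using less.prems by (auto simp: predicted_from_def)
    then show ?thesis using predict less.prems
      by (intro exI[of _ p0] exI[of _ "[(s, 0)]"] exI[of _ s]) (auto intro: earley_path.start)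
  next
    case (scan p0 i k X \<beta> a \<mu> r0)
    then obtain p' q h' where *: "length p' = r" "p0 = p' @ shift r q" "earley_path G h p'"
        "predicted_from G p' h'"
      "earley_path G h' q" "last q = (State i k X \<beta> (Tm a # \<mu>), 0)"
      using less.hyps[of p0] less.prems by auto
    show ?thesis using * scan less.prems earley_path.scan[OF *(5,6)]
      by (intro exI[of _ p'] exI[of _ "q @ [(s, 0)]"] exI[of _ h']) auto
  next
    case (complete p0 i j Y \<nu> r0 k X \<beta> \<mu> r')
    obtain p' q h' where *: "length p' = r0" "p0 = p' @ shift r0 q" "earley_path G h p'" "predicted_from
        G p' h'"
      "earley_path G h' q" "last q = (State i j (Some Y) \<nu> [], 0)"
      using less.hyps[of p0] complete by auto
    have r': "r' = r" "s = State i k X (\<beta> @ [NT Y]) \<mu>" using complete less.prems by auto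
    \<comment> \<open>As \<open>p'\<close> has length \<open>r0\<close>, the predictor at index
      \<open>r0 - 1\<close> is its last entry. The root index of that entry is again
      \<open>r > 0\<close>, which permits the second split.\<close>
    have last': "last p' = (State j k X \<beta> (NT Y # \<mu>), r)"
      using complete(5) * r' path_not_Nil[OF *(3)] by (auto simp: nth_append last_conv_nth)
    obtain p1 q1 h1 where **: "length p1 = r" "p' = p1 @ shift r q1" "earley_path G h p1"
        "predicted_from G p1 h1"
      "earley_path G h1 q1" "last q1 = (State j k X \<beta> (NT Y # \<mu>), 0)"
      using less.hyps[of p' _ r] * complete last' less.prems path_not_Nil[OF *(5)] by auto
    obtain \<nu>' where h': "h' = State j j (Some Y) [] \<nu>'" "(Y, \<nu>') \<in> prods G"
      using *(4) last' by (auto simp: predicted_from_def)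
    let ?q = "q1 @ shift (length q1) q"
    have q: "earley_path G h1 ?q" using path_append_shift[OF **(5,6) h'(2)] *(5) h'(1) by blast
    have l: "last ?q = (State i j (Some Y) \<nu> [], length q1)"
      using *(6) path_not_Nil[OF *(5)] last_shift by fastforce
    have n: "?q ! (length q1 - 1) = (State j k X \<beta> (NT Y # \<mu>), 0)"
      using **(6) path_not_Nil[OF **(5)] by (auto simp: nth_append last_conv_nth)
    have "earley_path G h1 (?q @ [(s, 0)])"
      using earley_path.complete[OF q l _ n] path_not_Nil[OF **(5)] r' by simp
    moreover have "r + length q1 = r0" using * ** by auto
    ultimately show ?thesis using * ** complete less.prems
      by (intro exI[of _ p1] exI[of _ "?q @ [(s, 0)]"] exI[of _ h1]) auto
  qed auto
qed

section \<open>Invariants and probabilities along a path\<close>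

lemma generated_snoc: "p \<noteq> [] \<Longrightarrow> generated (p @ [c]) = generated p @ scanned (fst (last p))"
  by (cases p rule: rev_cases) (simp_all add: generated_def butlast_append case_prod_beta)

lemma pos_last: "earley_path G h p \<Longrightarrow> pos (fst (last p)) = pos h + length (generated p)"
  by (induction rule: earley_path.induct) (auto simp: generated_snoc path_not_Nil, simp add: generated_def)

text \<open>The invariant concerns all entries at once, since completion combines the last entry
  with an earlier one. The bound on \<open>before\<close> holds because right-hand sides are
  nonempty: a completed expansion covers at least one position. Entries with root index 0 are the
  first state with its dot moved.\<close>

lemma path_items:
  assumes "earley_path G h p" "start_state G h" "no_null_productions G" "(s, r) \<in> set p"
  shows "is_state G s" "pos h \<le> pos s" "origin s + length (before s) \<le> pos s"
    and "r = 0 \<Longrightarrow> origin s = origin h \<and> lhs s = lhs h \<and> before s @ after s = before h @ after h"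
proof -
  let ?P = "\<lambda>s r. is_state G s \<and> pos h \<le> pos s \<and> origin s + length (before s) \<le> pos s \<and>
    (r = 0 \<longrightarrow> origin s = origin h \<and> lhs s = lhs h \<and> before s @ after s = before h @ after h)"
  have init: "?P h 0"
    using assms(2) by (auto simp: start_state_def initial_state_def is_predicted_def)
  have "?P s r"
    using assms(1,4)
  proof (induction arbitrary: s r)
    case start
    then show ?case using init by simp
  next
    case (predict p i k X \<beta> Y \<mu> r' \<nu>)
    note l = last_in_path[OF predict.hyps(1,2)]
    show ?case using predict.IH[OF l] predict.prems predict.hyps(3) predict.IH path_not_Nil[OF
        predict.hyps(1)]
      by auto
  next
    case (scan p i k X \<beta> a \<mu> r')
    note l = last_in_path[OF scan.hyps(1,2)]
    have "is_state G (State (Suc i) k X (\<beta> @ [Tm a]) \<mu>)"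
      using scan.IH[OF l] by (cases X) (auto simp: initial_state_def)
    then show ?case using scan.IH[OF l] scan.prems scan.IH by auto
  next
    case (complete p i j Y \<nu> r1 k X \<beta> \<mu> r')
    note l = last_in_path[OF complete.hyps(1,2)]
    have m: "(State j k X \<beta> (NT Y # \<mu>), r') \<in> set p"
      by (metis nth_mem less_imp_diff_less complete.hyps(4) path_last_root_less[OF complete.hyps(1,2)])
    have "\<nu> \<noteq> []"
      using complete.IH[OF l] assms(3) by (auto simp: no_null_productions_def)
    then have \<nu>: "0 < length \<nu>" by simp
    have "is_state G (State i k X (\<beta> @ [NT Y]) \<mu>)"
      using complete.IH[OF l] complete.IH[OF m] by (cases X) (auto simp: initial_state_def)
    moreover have "j + length \<nu> \<le> i" "k + length \<beta> \<le> j"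
      using complete.IH[OF l] complete.IH[OF m] by auto
    with \<nu> have "k + length \<beta> < i" by linarith
    then have "k + length (\<beta> @ [NT Y]) \<le> i" by simp
    ultimately show ?case using complete.IH[OF l] complete.IH[OF m] complete.prems complete.IH
      by auto
  qed
  then show "is_state G s" "pos h \<le> pos s" "origin s + length (before s) \<le> pos s"
    and "r = 0 \<Longrightarrow> origin s = origin h \<and> lhs s = lhs h \<and> before s @ after s = before h @ after h"
    by auto
qed

lemma path_prob_append: "path_prob G (p @ q) = path_prob G p * path_prob G q"
  by (simp add: path_prob_def)

lemma path_prob_shift [simp]: "path_prob G (shift n p) = path_prob G p"
  by (induction p) (auto simp: path_prob_def)

lemma path_prob_single: "path_prob G [(s, r)] = state_factor G s"
  by (simp add: path_prob_def)

lemma state_factor_moved: "before s \<noteq> [] \<Longrightarrow> state_factor G s = 1"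
  by (auto simp: state_factor_def is_predicted_def)

lemma state_factor_nonneg: "is_scfg G \<Longrightarrow> 0 \<le> state_factor G s"
  by (auto simp: state_factor_def is_predicted_def prob_nonneg)

lemma path_prob_nonneg: "is_scfg G \<Longrightarrow> 0 \<le> path_prob G p"
  by (induction p) (auto simp: path_prob_def state_factor_nonneg)

section \<open>Path sets and the three Earley operations\<close>

text \<open>The predicate on the root index of the last state is trivial for forward and \<open>\<lambda>r. r = 0\<close> for
  inner paths; scanning and completion treat both alike. The length condition of the original
  definitions follows from the other ones.\<close>

definition paths_to :: "('n, 't) scfg \<Rightarrow> 't list \<Rightarrow> ('n, 't) state \<Rightarrow> (nat \<Rightarrow> bool) \<Rightarrow> ('n, 't) state \<Rightarrow> ('n,
    't) path set" where
  "paths_to G x h Q s = {p. start_state G h \<and> earley_path G h p \<and> fst (last p) = s \<and> Q (snd (last p)) \<and>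
     generated p = take (pos s - pos h) (drop (pos h) x)}"

lemma forward_paths_eq: "forward_paths G x s = paths_to G x (initial_state G) (\<lambda>_. True) s"
proof -
  have "path_length p = pos s" if "earley_path G (initial_state G) p" "fst (last p) = s" for p
    using pos_last[OF that(1)] that(2) by (simp add: path_length_def initial_state_def)
  moreover have "pos (initial_state G) = 0" by (simp add: initial_state_def)
  ultimately show ?thesis
    unfolding forward_paths_def paths_to_def conj_assoc[symmetric] is_path_iff_path by auto
qed

lemma inner_paths_eq:
  "inner_paths G x s = paths_to G x (State (origin s) (origin s) (lhs s) [] (before s @ after s)) (\<lambda>r. r
      = 0) s"
proof -
  have "path_length p = pos s - origin s"
    if "earley_path G (State (origin s) (origin s) (lhs s) [] (before s @ after s)) p" "fst (last p) =
        s" for p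
    using pos_last[OF that(1)] that(2) by (simp add: path_length_def)
  then show ?thesis
    unfolding inner_paths_def paths_to_def conj_assoc[symmetric] is_path_iff_path by auto
qed

lemma start_state_before: "start_state G h \<Longrightarrow> before h = []"
  by (auto simp: start_state_def initial_state_def is_predicted_def)

text \<open>For the last bound, \<open>generated p\<close> has length \<open>pos s - pos h\<close>,
  and as a \<open>take\<close> of the remaining input it is no longer than that input.\<close>

lemma paths_to_state:
  assumes "no_null_productions G" "p \<in> paths_to G x h Q s"
  shows "is_state G s" "pos h \<le> pos s" "origin s + length (before s) \<le> pos s" "start_state G h"
    "pos s - pos h \<le> length (drop (pos h) x)"
proof -
  have p: "earley_path G h p" "start_state G h" "last p = (s, snd (last p))"
    using assms(2) by (auto simp: paths_to_def prod_eq_iff)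
  note * = path_items[OF p(1,2) assms(1) last_in_path[OF p(1,3)]]
  show "is_state G s" "pos h \<le> pos s" "origin s + length (before s) \<le> pos s" "start_state G h"
    using * p by auto
  have "length (take (pos s - pos h) (drop (pos h) x)) = pos s - pos h"
    using assms(2) pos_last[OF p(1)] by (auto simp: paths_to_def)
  then show "pos s - pos h \<le> length (drop (pos h) x)" by simp
qed

lemma paths_to_empty:
  assumes "no_null_productions G" "pos s < origin s + length (before s)"
  shows "paths_to G x h Q s = {}"
  using paths_to_state(3)[OF assms(1)] assms(2) by (metis equals0I not_le)

definition scan_ext :: "('n, 't) state \<Rightarrow> ('n, 't) path \<Rightarrow> ('n, 't) path" where
  "scan_ext s p = p @ [(s, snd (last p))]"

text \<open>The expansion \<open>q\<close> is predicted by the last state of \<open>p\<close> and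
  begins at list position \<open>length p\<close>, hence the shift. The final state continues that
  predictor and inherits its root index \<open>snd (last p)\<close>.\<close>

definition complete_ext :: "('n, 't) state \<Rightarrow> ('n, 't) path \<Rightarrow> ('n, 't) path \<Rightarrow> ('n, 't) path" where
  "complete_ext s p q = p @ shift (length p) q @ [(s, snd (last p))]"

definition predict_ext :: "('n, 't) state \<Rightarrow> ('n, 't) path \<Rightarrow> ('n, 't) path" where
  "predict_ext s p = p @ [(s, length p)]"

lemma scan_ext_in_paths_to:
  assumes "no_null_productions G" "p \<in> paths_to G x h Q (State i k X \<beta> (Tm a # \<mu>))" "i < length x" "a = x ! i"
  shows "scan_ext (State (Suc i) k X (\<beta> @ [Tm a]) \<mu>) p \<in> paths_to G x h Q (State (Suc i) k X (\<beta> @ [Tm a]) \<mu>)"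
proof -
  have p: "earley_path G h p" "start_state G h" "last p = (State i k X \<beta> (Tm a # \<mu>), snd (last p))"
    "generated p = take (i - pos h) (drop (pos h) x)" "Q (snd (last p))"
    using assms(2) by (auto simp: paths_to_def prod_eq_iff)
  have h: "pos h \<le> i" using paths_to_state[OF assms(1,2)] by simp
  have "take (Suc i - pos h) (drop (pos h) x) = take (i - pos h) (drop (pos h) x) @ [a]"
    using h assms(3,4) by (simp add: Suc_diff_le take_Suc_conv_app_nth)
  moreover have "scanned (fst (last p)) = [a]" by (subst p(3)) simp
  ultimately show ?thesis
    using earley_path.scan[OF p(1,3)] p(2,4,5) path_not_Nil[OF p(1)]
    by (auto simp: paths_to_def scan_ext_def generated_snoc)
qed

text \<open>Only scanning puts a terminal before the dot. Comparing the last letters of the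
  generated string and of the matching piece of input shows that the scanned letter is
  \<open>x ! i'\<close>.\<close>

lemma paths_to_scan_cases:
  assumes "no_null_productions G" "p \<in> paths_to G x h Q (State i k X (\<beta> @ [Tm a]) \<mu>)"
  obtains i' p' where "i = Suc i'" "i' < length x" "a = x ! i'"
    "p' \<in> paths_to G x h Q (State i' k X \<beta> (Tm a # \<mu>))" "p = scan_ext (State i k X (\<beta> @ [Tm a]) \<mu>) p'"
proof -
  have p: "earley_path G h p" "start_state G h" "fst (last p) = State i k X (\<beta> @ [Tm a]) \<mu>"
    "generated p = take (i - pos h) (drop (pos h) x)" "Q (snd (last p))"
    using assms(2) by (auto simp: paths_to_def)
  note s = paths_to_state[OF assms]
  from p(1) show ?thesis
  proof (cases rule: earley_path.cases)
    case (scan p' i' k' X' \<beta>' a' \<mu>' r)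
    have i: "i = Suc i'" and eq: "k' = k" "X' = X" "\<beta>' = \<beta>" "a' = a" "\<mu>' = \<mu>" using scan p(3) by auto
    have h: "pos h \<le> i'"
      using path_items(2)[OF scan(2) p(2) assms(1) last_in_path[OF scan(2,3)]] by simp
    have len: "i' - pos h < length (drop (pos h) x)" using s(5) i h by auto
    have "generated p = generated p' @ [a]" using scan eq path_not_Nil[OF scan(2)] by (simp add:
        generated_snoc)
    moreover have "take (i - pos h) (drop (pos h) x) = take (i' - pos h) (drop (pos h) x) @ [x ! i']"
      using h len i by (simp add: Suc_diff_le take_Suc_conv_app_nth)
    ultimately have "generated p' = take (i' - pos h) (drop (pos h) x)" "a = x ! i'" using p(4) by auto
    moreover have "i' < length x" using len h by auto
    ultimately show ?thesis
      using scan eq i p by (intro that[of i' p']) (auto simp: paths_to_def scan_ext_def)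
  qed (use p start_state_before[OF p(2)] in auto)
qed

lemma concat_scanned_eq: "p \<noteq> [] \<Longrightarrow> concat (map (\<lambda>(s, r). scanned s) p) = generated p @ scanned (fst (last p))"
  by (cases p rule: rev_cases) (auto simp: generated_def)

lemma concat_scanned_shift: "concat (map (\<lambda>(s, r). scanned s) (shift n p)) = concat (map (\<lambda>(s, r).
    scanned s) p)"
  by (induction p) auto

lemma generated_complete_ext:
  assumes "p \<noteq> []" "q \<noteq> []" "scanned (fst (last p)) = []" "scanned (fst (last q)) = []"
  shows "generated (complete_ext s p q) = generated p @ generated q"
proof -
  have "generated (complete_ext s p q) =
      concat (map (\<lambda>(s, r). scanned s) p) @ concat (map (\<lambda>(s, r). scanned s) q)"
    by (simp add: complete_ext_def generated_def butlast_append concat_scanned_shift)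
  then show ?thesis using assms by (simp add: concat_scanned_eq)
qed

lemma complete_ext_in_paths_to:
  assumes "no_null_productions G" "p \<in> paths_to G x h Q (State j k X \<beta> (NT Z # \<mu>))"
    and "(Z, \<nu>) \<in> prods G" "q \<in> inner_paths G x (State i j (Some Z) \<nu> [])"
  shows "complete_ext (State i k X (\<beta> @ [NT Z]) \<mu>) p q \<in> paths_to G x h Q (State i k X (\<beta> @ [NT Z]) \<mu>)"
proof -
  have p: "earley_path G h p" "start_state G h" "last p = (State j k X \<beta> (NT Z # \<mu>), snd (last p))"
    "generated p = take (j - pos h) (drop (pos h) x)" "Q (snd (last p))"
    using assms(2) by (auto simp: paths_to_def prod_eq_iff)
  have q: "earley_path G (State j j (Some Z) [] \<nu>) q" "last q = (State i j (Some Z) \<nu> [], 0)"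
    "generated q = take (i - j) (drop j x)"
    using assms(4) unfolding inner_paths_eq by (auto simp: paths_to_def prod_eq_iff)
  have h: "pos h \<le> j" using paths_to_state[OF assms(1,2)] by simp
  have j: "j \<le> i" using paths_to_state[OF assms(1) assms(4)[unfolded inner_paths_eq]] by simp
  let ?p = "p @ shift (length p) q"
  note ne = path_not_Nil[OF p(1)] path_not_Nil[OF q(1)]
  have l: "last ?p = (State i j (Some Z) \<nu> [], length p)"
    using ne last_shift[OF _ q(2)] by simp
  have n: "?p ! (length p - 1) = (State j k X \<beta> (NT Z # \<mu>), snd (last p))"
    using ne p(3) by (auto simp: nth_append last_conv_nth)
  have "earley_path G h (complete_ext (State i k X (\<beta> @ [NT Z]) \<mu>) p q)"
    using earley_path.complete[OF path_append_shift[OF p(1,3) assms(3) q(1)] l _ n] ne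
    by (simp add: complete_ext_def)
  moreover have "generated (complete_ext (State i k X (\<beta> @ [NT Z]) \<mu>) p q) = generated p @ generated q"
  proof (rule generated_complete_ext[OF ne])
    show "scanned (fst (last p)) = []" by (subst p(3)) simp
  qed (simp add: q(2))
  moreover have "take (j - pos h) (drop (pos h) x) @ take (i - j) (drop j x) = take (i - pos h) (drop
      (pos h) x)"
    using take_add[of "j - pos h" "i - j" "drop (pos h) x"] h j by simp
  ultimately show ?thesis
    using p q by (simp add: paths_to_def complete_ext_def)
qed

text \<open>The cut is at the root index of the completed expansion. The positions fix the lengths
  of both generated strings, so the piece of input splits accordingly. The condition
  \<open>Q\<close> carries over to \<open>p'\<close> because completion restores the root index of
  the predictor.\<close>

lemma paths_to_complete_cases:
  assumes "no_null_productions G" "p \<in> paths_to G x h Q (State i k X (\<beta> @ [NT Z]) \<mu>)"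
  obtains j \<nu> p' q where "k \<le> j" "j < i" "(Z, \<nu>) \<in> prods G"
    "p' \<in> paths_to G x h Q (State j k X \<beta> (NT Z # \<mu>))" "q \<in> inner_paths G x (State i j (Some Z) \<nu> [])"
    "p = complete_ext (State i k X (\<beta> @ [NT Z]) \<mu>) p' q"
proof -
  have p: "earley_path G h p" "start_state G h" "fst (last p) = State i k X (\<beta> @ [NT Z]) \<mu>"
    "generated p = take (i - pos h) (drop (pos h) x)" "Q (snd (last p))"
    using assms(2) by (auto simp: paths_to_def)
  from p(1) show ?thesis
  proof (cases rule: earley_path.cases)
    case (complete p0 i' j Y \<nu> r k' X' \<beta>' \<mu>' r')
    have eq: "i' = i" "k' = k" "X' = X" "\<beta>' = \<beta>" "Y = Z" "\<mu>' = \<mu>" using complete p(3) by auto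
    obtain p1 q h' where *: "length p1 = r" "p0 = p1 @ shift r q" "earley_path G h p1" "predicted_from G
        p1 h'"
      "earley_path G h' q" "last q = (State i j (Some Z) \<nu> [], 0)"
      using path_decompose[OF complete(2,3,4)] eq by blast
    note ne = path_not_Nil[OF *(3)] path_not_Nil[OF *(5)]
    have l: "last p1 = (State j k X \<beta> (NT Z # \<mu>), r')"
      using complete(5) * ne eq by (auto simp: nth_append last_conv_nth)
    obtain \<nu>' where h': "h' = State j j (Some Z) [] \<nu>'" "(Z, \<nu>') \<in> prods G"
      using *(4) l by (auto simp: predicted_from_def)
    have sh': "start_state G h'" using h' by (auto simp: start_state_def is_predicted_def)
    note q = path_items[OF *(5) sh' assms(1) last_in_path[OF *(5,6)]]
    \<comment> \<open>Root index 0 ties the last state of \<open>q\<close> to its first one, which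
      identifies the predicted right-hand side with the completed one.\<close>
    have \<nu>: "\<nu>' = \<nu>" using q(4) h' by simp
    have "\<nu> \<noteq> []" using h' \<nu> assms(1) by (auto simp: no_null_productions_def)
    then have "0 < length \<nu>" by simp
    moreover have "j + length \<nu> \<le> i" using q(3) by simp
    ultimately have ji: "j < i" by linarith
    note p1 = path_items[OF *(3) p(2) assms(1) last_in_path[OF *(3) l]]
    have kj: "k \<le> j" and hj: "pos h \<le> j" using p1 by simp_all
    have pe: "p = complete_ext (State i k X (\<beta> @ [NT Z]) \<mu>) p1 q"
      using complete(1) * l eq by (simp add: complete_ext_def)
    have "generated p = generated p1 @ generated q"
      unfolding pe by (rule generated_complete_ext[OF ne]) (simp_all add: l *(6))
    then have g: "take (length (generated p1)) (generated p) = generated p1"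
      and g2: "drop (length (generated p1)) (generated p) = generated q"
      by simp_all
    have len: "length (generated p1) = j - pos h"
      using pos_last[OF *(3)] l by simp
    have "generated p1 = take (j - pos h) (drop (pos h) x)"
      using g ji hj unfolding len p(4) by (simp add: min_absorb1)
    moreover have "generated q = take (i - j) (drop j x)"
      using g2 ji hj unfolding len p(4) by (simp add: drop_take)
    moreover have "Q r'" using p(5) complete(1) by simp
    ultimately show ?thesis
      using that[of j \<nu> p1 q] kj ji h' \<nu> pe p(2,5) sh' * l complete(1)
      by (auto simp: paths_to_def inner_paths_eq)
  qed (use p start_state_before[OF p(2)] in auto)
qed

text \<open>The entry before the final one has root index \<open>length p\<close>, so the cut can be
  read off the composed path.\<close>

lemma complete_ext_inj:
  assumes "complete_ext s p q = complete_ext s p' q'"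
    and "last q = (t, 0)" "last q' = (t', 0)" "q \<noteq> []" "q' \<noteq> []"
  shows "p = p' \<and> q = q'"
proof -
  have e: "p @ shift (length p) q = p' @ shift (length p') q'"
    using arg_cong[OF assms(1), of butlast] by (simp add: complete_ext_def butlast_append)
  have "last (p @ shift (length p) q) = (t, length p)" "last (p' @ shift (length p') q') = (t', length p')"
    using last_shift[OF assms(4,2)] last_shift[OF assms(5,3)] assms(4,5) by simp_all
  then have "length p = length p'" using e by simp
  then show ?thesis using e by (simp add: inj_shift)
qed

lemma predict_ext_in_paths_to:
  assumes "p \<in> paths_to G x h (\<lambda>_. True) (State i k X \<beta> (NT Y # \<mu>))" "(Y, \<nu>) \<in> prods G"
  shows "predict_ext (State i i (Some Y) [] \<nu>) p \<in> paths_to G x h (\<lambda>_. True) (State i i (Some Y) [] \<nu>)"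
proof -
  have p: "earley_path G h p" "start_state G h" "last p = (State i k X \<beta> (NT Y # \<mu>), snd (last p))"
    "generated p = take (i - pos h) (drop (pos h) x)"
    using assms(1) by (auto simp: paths_to_def prod_eq_iff)
  moreover have "scanned (fst (last p)) = []" by (subst p(3)) simp
  ultimately show ?thesis
    using earley_path.predict[OF p(1,3) assms(2)] path_not_Nil[OF p(1)]
    by (auto simp: paths_to_def predict_ext_def generated_snoc)
qed

lemma paths_to_predict_cases:
  assumes "no_null_productions G" "p \<in> paths_to G x (initial_state G) (\<lambda>_. True) (State i i (Some Y) [] \<nu>)"
  obtains k X \<beta> \<mu> p' where "is_state G (State i k X \<beta> (NT Y # \<mu>))"
    "p' \<in> paths_to G x (initial_state G) (\<lambda>_. True) (State i k X \<beta> (NT Y # \<mu>))"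
    "p = predict_ext (State i i (Some Y) [] \<nu>) p'"
proof -
  let ?h = "initial_state G"
  have p: "earley_path G ?h p" "start_state G ?h" "fst (last p) = State i i (Some Y) [] \<nu>"
    "generated p = take (i - pos ?h) (drop (pos ?h) x)"
    using assms(2) by (auto simp: paths_to_def)
  from p(1) show ?thesis
  proof (cases rule: earley_path.cases)
    case start
    then show ?thesis using p(3) by (simp add: initial_state_def)
  next
    case (predict p' i' k X \<beta> Y' \<mu> r \<nu>')
    then have "p' \<in> paths_to G x ?h (\<lambda>_. True) (State i k X \<beta> (NT Y # \<mu>))"
      using p path_not_Nil[OF predict(2)] by (auto simp: paths_to_def generated_snoc)
    then show ?thesis
      using predict p(3) paths_to_state(1)[OF assms(1)] by (intro that[of k X \<beta> \<mu> p']) (auto simp: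
          predict_ext_def)
  qed (use p in auto)
qed

text \<open>Left recursion may predict the same state again, but then with a positive root index, so
  only the one-state path qualifies.\<close>

lemma inner_paths_start:
  "inner_paths G x (State i k X [] \<mu>) =
    (if start_state G (State i k X [] \<mu>) \<and> i = k then {[(State i k X [] \<mu>, 0)]} else {})"
proof -
  have "p = [(State i k X [] \<mu>, 0)] \<and> start_state G (State i k X [] \<mu>) \<and> i = k"
    if "p \<in> inner_paths G x (State i k X [] \<mu>)" for p
  proof -
    have p: "earley_path G (State k k X [] \<mu>) p" "start_state G (State k k X [] \<mu>)"
      "fst (last p) = State i k X [] \<mu>" "snd (last p) = 0"
      using that unfolding inner_paths_eq by (auto simp: paths_to_def)
    from p(1) show ?thesis
    proof (cases rule: earley_path.cases)
      case start
      then show ?thesis using p by auto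
    next
      case predict
      then show ?thesis using p(4) path_not_Nil by auto
    qed (use p in auto)
  qed
  moreover have "[(State i k X [] \<mu>, 0)] \<in> inner_paths G x (State i k X [] \<mu>)"
    if "start_state G (State i k X [] \<mu>)" "i = k"
    using that earley_path.start[of G "State i k X [] \<mu>"]
    unfolding inner_paths_eq by (simp add: paths_to_def generated_def)
  ultimately show ?thesis by auto
qed

lemma forward_paths_initial: "forward_paths G x (initial_state G) = {[(initial_state G, 0)]}"
proof -
  have "p = [(initial_state G, 0)]" if "earley_path G (initial_state G) p" "fst (last p) = initial_state
      G" for p
    using that by (cases rule: earley_path.cases) (auto simp: initial_state_def)
  moreover have "start_state G (initial_state G)" by (simp add: start_state_def)
  ultimately show ?thesis
    unfolding forward_paths_eq paths_to_def by (auto simp: generated_def intro: earley_path.start)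
qed

section \<open>Recurrences for extended nonnegative sums\<close>

text \<open>Integration against the counting measure makes bijections, iterated sums and monotone
  convergence available before anything is known to be finite.\<close>

abbreviation nsum :: "('a \<Rightarrow> ennreal) \<Rightarrow> 'a set \<Rightarrow> ennreal" where
  "nsum f A \<equiv> nn_integral (count_space A) f"

lemma nsum_image: "inj_on g A \<Longrightarrow> nsum f (g ` A) = nsum (\<lambda>a. f (g a)) A"
  by (rule nn_integral_bij_count_space[symmetric]) (simp add: bij_betw_def)

lemma nsum_Sigma: "nsum f (Sigma A B) = nsum (\<lambda>a. nsum (\<lambda>b. f (a, b)) (B a)) A"
proof -
  have "nsum f (Sigma A B) = nsum (\<lambda>z. f z * indicator (Sigma A B) z) UNIV"
    by (rule nn_integral_count_space_indicator) simp
  also have "\<dots> = nsum (\<lambda>a. nsum (\<lambda>b. f (a, b) * indicator (Sigma A B) (a, b)) UNIV) UNIV"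
    by (rule nn_integral_fst_count_space[symmetric])
  also have "\<dots> = nsum (\<lambda>a. nsum (\<lambda>b. f (a, b)) (B a) * indicator A a) UNIV"
  proof (intro nn_integral_cong)
    fix a
    have "nsum (\<lambda>b. f (a, b) * indicator (Sigma A B) (a, b)) UNIV = nsum (\<lambda>b. (f (a, b) * indicator (B
        a) b) * indicator A a) UNIV"
      by (intro nn_integral_cong) (auto split: split_indicator)
    also have "\<dots> = nsum (\<lambda>b. f (a, b)) (B a) * indicator A a"
      by (simp add: nn_integral_multc nn_integral_count_space_indicator[of "B a"])
    finally show "nsum (\<lambda>b. f (a, b) * indicator (Sigma A B) (a, b)) UNIV = nsum (\<lambda>b. f (a, b)) (B a) *
        indicator A a" .
  qed
  also have "\<dots> = nsum (\<lambda>a. nsum (\<lambda>b. f (a, b)) (B a)) A"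
    by (rule nn_integral_count_space_indicator[symmetric]) simp
  finally show ?thesis .
qed

lemma nsum_finite: "finite A \<Longrightarrow> nsum f A = sum f A"
  by (rule nn_integral_count_space_finite)

lemma nsum_scan:
  assumes "no_null_productions G" "i < length x" "a = x ! i"
  shows "nsum f (paths_to G x h Q (State (Suc i) k X (\<beta> @ [Tm a]) \<mu>)) =
    nsum (\<lambda>p. f (scan_ext (State (Suc i) k X (\<beta> @ [Tm a]) \<mu>) p)) (paths_to G x h Q (State i k X \<beta> (Tm a
        # \<mu>)))"
proof -
  let ?s = "State (Suc i) k X (\<beta> @ [Tm a]) \<mu>"
  have "paths_to G x h Q ?s = scan_ext ?s ` paths_to G x h Q (State i k X \<beta> (Tm a # \<mu>))"
  proof
    show "paths_to G x h Q ?s \<subseteq> scan_ext ?s ` paths_to G x h Q (State i k X \<beta> (Tm a # \<mu>))"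
    proof
      fix p assume "p \<in> paths_to G x h Q ?s"
      from paths_to_scan_cases[OF assms(1) this]
      show "p \<in> scan_ext ?s ` paths_to G x h Q (State i k X \<beta> (Tm a # \<mu>))" by blast
    qed
    show "scan_ext ?s ` paths_to G x h Q (State i k X \<beta> (Tm a # \<mu>)) \<subseteq> paths_to G x h Q ?s"
      using scan_ext_in_paths_to[OF assms(1) _ assms(2,3)] by blast
  qed
  moreover have "inj_on (scan_ext ?s) A" for A by (auto simp: inj_on_def scan_ext_def)
  ultimately show ?thesis by (simp add: nsum_image)
qed

lemma nsum_complete:
  fixes G :: "('n::finite, 't::finite) scfg"
  assumes "is_scfg G" "no_null_productions G"
  shows "nsum f (paths_to G x h Q (State i k X (\<beta> @ [NT Z]) \<mu>)) =
    (\<Sum>j\<in>{k..<i}. \<Sum>\<nu> | (Z, \<nu>) \<in> prods G.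
      nsum (\<lambda>p. nsum (\<lambda>q. f (complete_ext (State i k X (\<beta> @ [NT Z]) \<mu>) p q)) (inner_paths G x (State i j
          (Some Z) \<nu> [])))
        (paths_to G x h Q (State j k X \<beta> (NT Z # \<mu>))))"
proof -
  let ?s = "State i k X (\<beta> @ [NT Z]) \<mu>"
  let ?A = "SIGMA j:{k..<i}. {\<nu>. (Z, \<nu>) \<in> prods G}"
  let ?B = "\<lambda>(j, \<nu>). paths_to G x h Q (State j k X \<beta> (NT Z # \<mu>)) \<times> inner_paths G x (State i j (Some Z) \<nu> [])"
  let ?g = "\<lambda>((j :: nat, \<nu> :: ('n, 't) sym list), p, q). complete_ext ?s p q"
  have "paths_to G x h Q ?s = ?g ` Sigma ?A ?B"
  proof
    show "paths_to G x h Q ?s \<subseteq> ?g ` Sigma ?A ?B"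
    proof
      fix p assume "p \<in> paths_to G x h Q ?s"
      from paths_to_complete_cases[OF assms(2) this] obtain j \<nu> p' q where
        "k \<le> j" "j < i" "(Z, \<nu>) \<in> prods G" "p' \<in> paths_to G x h Q (State j k X \<beta> (NT Z # \<mu>))"
        "q \<in> inner_paths G x (State i j (Some Z) \<nu> [])" "p = complete_ext ?s p' q" .
      then show "p \<in> ?g ` Sigma ?A ?B" by (intro image_eqI[of _ _ "((j, \<nu>), p', q)"]) auto
    qed
    show "?g ` Sigma ?A ?B \<subseteq> paths_to G x h Q ?s"
      using complete_ext_in_paths_to[OF assms(2)] by auto
  qed
  moreover have "inj_on ?g (Sigma ?A ?B)"
  proof (rule inj_onI)
    fix z z' assume z: "z \<in> Sigma ?A ?B" "z' \<in> Sigma ?A ?B" and "?g z = ?g z'"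
    obtain j \<nu> p q where z_eq: "z = ((j, \<nu>), p, q)" by (metis surj_pair)
    obtain j' \<nu>' p' q' where z'_eq: "z' = ((j', \<nu>'), p', q')" by (metis surj_pair)
    have q: "q \<in> inner_paths G x (State i j (Some Z) \<nu> [])" "q' \<in> inner_paths G x (State i j' (Some Z) \<nu>' [])"
      and e: "complete_ext ?s p q = complete_ext ?s p' q'"
      using z \<open>?g z = ?g z'\<close> by (auto simp: z_eq z'_eq)
    \<comment> \<open>The last state of \<open>q\<close> displays \<open>j\<close> and
      \<open>\<nu>\<close>, so the composed path determines the index pair as well.\<close>
    have l: "last q = (State i j (Some Z) \<nu> [], 0)" "last q' = (State i j' (Some Z) \<nu>' [], 0)" "q \<noteq> []"
        "q' \<noteq> []"
      using q unfolding inner_paths_eq by (auto simp: paths_to_def prod_eq_iff dest: path_not_Nil)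
    from complete_ext_inj[OF e l] l
    show "z = z'" by (simp add: z_eq z'_eq)
  qed
  ultimately have "nsum f (paths_to G x h Q ?s) = nsum (\<lambda>z. f (?g z)) (Sigma ?A ?B)"
    by (simp only: nsum_image)
  also have "\<dots> = nsum (\<lambda>(j, \<nu>). nsum (\<lambda>p. nsum (\<lambda>q. f (complete_ext ?s p q)) (inner_paths G x (State i j
      (Some Z) \<nu> [])))
        (paths_to G x h Q (State j k X \<beta> (NT Z # \<mu>)))) ?A"
    unfolding nsum_Sigma[of ?A] by (intro nn_integral_cong) (auto simp: nsum_Sigma)
  also have "\<dots> = (\<Sum>j\<in>{k..<i}. \<Sum>\<nu> | (Z, \<nu>) \<in> prods G.
      nsum (\<lambda>p. nsum (\<lambda>q. f (complete_ext ?s p q)) (inner_paths G x (State i j (Some Z) \<nu> [])))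
        (paths_to G x h Q (State j k X \<beta> (NT Z # \<mu>))))"
    using finite_rhs[OF assms(1), of Z] by (simp add: nsum_finite sum.Sigma)
  finally show ?thesis .
qed

definition expecting :: "('n, 't) scfg \<Rightarrow> nat \<Rightarrow> 'n \<Rightarrow> (nat \<times> 'n option \<times> ('n, 't) sym list \<times> ('n, 't) sym
    list) set" where
  "expecting G i Y = {(k, X, \<beta>, \<mu>). is_state G (State i k X \<beta> (NT Y # \<mu>))}"

text \<open>A state at position \<open>i\<close> is coded by its origin, its left-hand side, a
  right-hand side and a dot position; the dummy production contributes the additional right-hand
  side \<open>[NT (start G)]\<close>.\<close>

lemma finite_states:
  fixes G :: "('n::finite, 't::finite) scfg"
  assumes "is_scfg G"
  shows "finite {s. is_state G s \<and> pos s = i}"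
proof (rule finite_subset)
  let ?R = "insert [NT (start G)] (snd ` prods G)"
  let ?f = "\<lambda>(k, X, r, n). State i k X (take n r) (drop n r)"
  show "finite (?f ` ({..i} \<times> UNIV \<times> (SIGMA r:?R. {..length r})))"
    using assms by (intro finite_imageI finite_cartesian_product finite_SigmaI) (auto simp: is_scfg_def)
  show "{s. is_state G s \<and> pos s = i} \<subseteq> ?f ` ({..i} \<times> UNIV \<times> (SIGMA r:?R. {..length r}))"
  proof clarify
    fix s :: "('n, 't) state" assume "is_state G s" "i = pos s"
    then show "s \<in> (\<lambda>(k, X, r, n). State (pos s) k X (take n r) (drop n r)) ` ({..pos s} \<times> UNIV \<times> (SIGMA
        r:?R. {..length r}))"
      by (cases "(G, s)" rule: is_state.cases)
        (force simp: initial_state_def intro!: image_eqI[of _ _ "(origin s, lhs s, before s @ after s,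
            length (before s))"])+
  qed
qed

lemma finite_expecting:
  fixes G :: "('n::finite, 't::finite) scfg"
  assumes "is_scfg G"
  shows "finite (expecting G i Y)"
  using finite_vimageI[OF finite_states[OF assms, of i], of "\<lambda>(k, X, \<beta>, \<mu>). State i k X \<beta> (NT Y # \<mu>)"]
  by (rule rev_finite_subset) (auto simp: inj_on_def expecting_def)

lemma nsum_predict:
  fixes G :: "('n::finite, 't::finite) scfg"
  assumes "is_scfg G" "no_null_productions G" "(Y, \<nu>) \<in> prods G"
  shows "nsum f (forward_paths G x (State i i (Some Y) [] \<nu>)) =
    (\<Sum>(k, X, \<beta>, \<mu>)\<in>expecting G i Y.
      nsum (\<lambda>p. f (predict_ext (State i i (Some Y) [] \<nu>) p)) (forward_paths G x (State i k X \<beta> (NT Y # \<mu>))))"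
proof -
  let ?s = "State i i (Some Y) [] \<nu>"
  let ?B = "\<lambda>(k, X, \<beta>, \<mu>). forward_paths G x (State i k X \<beta> (NT Y # \<mu>))"
  let ?g = "\<lambda>(_ :: nat \<times> 'n option \<times> ('n, 't) sym list \<times> ('n, 't) sym list, p). predict_ext ?s p"
  have "forward_paths G x ?s = ?g ` Sigma (expecting G i Y) ?B"
  proof
    show "forward_paths G x ?s \<subseteq> ?g ` Sigma (expecting G i Y) ?B"
    proof
      fix p assume "p \<in> forward_paths G x ?s"
      then have "p \<in> paths_to G x (initial_state G) (\<lambda>_. True) ?s" by (simp add: forward_paths_eq)
      from paths_to_predict_cases[OF assms(2) this] obtain k X \<beta> \<mu> p' where
        "is_state G (State i k X \<beta> (NT Y # \<mu>))"
        "p' \<in> paths_to G x (initial_state G) (\<lambda>_. True) (State i k X \<beta> (NT Y # \<mu>))" "p = predict_ext ?s p'" .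
      then show "p \<in> ?g ` Sigma (expecting G i Y) ?B"
        by (intro image_eqI[of _ _ "((k, X, \<beta>, \<mu>), p')"]) (auto simp: expecting_def forward_paths_eq)
    qed
    show "?g ` Sigma (expecting G i Y) ?B \<subseteq> forward_paths G x ?s"
      using predict_ext_in_paths_to[OF _ assms(3)] by (auto simp: forward_paths_eq)
  qed
  moreover have "inj_on ?g (Sigma (expecting G i Y) ?B)"
    by (auto simp: inj_on_def predict_ext_def forward_paths_def)
  ultimately have "nsum f (forward_paths G x ?s) = nsum (\<lambda>z. f (?g z)) (Sigma (expecting G i Y) ?B)"
    by (simp only: nsum_image)
  then show ?thesis
    by (simp add: nsum_Sigma nsum_finite finite_expecting[OF assms(1)] case_prod_beta)
qed

text \<open>Only paths with at most \<open>N\<close> states count; \<open>N = \<infinity>\<close> gives the path probability itself.\<close>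

definition truncated_prob :: "('n, 't) scfg \<Rightarrow> enat \<Rightarrow> ('n, 't) path \<Rightarrow> ennreal" where
  "truncated_prob G N p = (if enat (length p) \<le> N then ennreal (path_prob G p) else 0)"

definition forward_sum :: "('n, 't) scfg \<Rightarrow> 't list \<Rightarrow> enat \<Rightarrow> ('n, 't) state \<Rightarrow> ennreal" where
  "forward_sum G x N s = nsum (truncated_prob G N) (forward_paths G x s)"

definition inner_sum :: "('n, 't) scfg \<Rightarrow> 't list \<Rightarrow> enat \<Rightarrow> ('n, 't) state \<Rightarrow> ennreal" where
  "inner_sum G x N s = nsum (truncated_prob G N) (inner_paths G x s)"

lemma truncated_prob_infinity: "truncated_prob G \<infinity> p = ennreal (path_prob G p)"
  by (simp add: truncated_prob_def)

lemma truncated_prob_mono: "M \<le> N \<Longrightarrow> truncated_prob G M p \<le> truncated_prob G N p"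
  by (auto simp: truncated_prob_def dest: order.trans)

lemma truncated_prob_predict_ext:
  assumes "is_scfg G" "(Y, \<nu>) \<in> prods G"
  shows "truncated_prob G (eSuc N) (predict_ext (State i i (Some Y) [] \<nu>) p) =
    truncated_prob G N p * ennreal (prob G (Y, \<nu>))"
proof -
  have "state_factor G (State i i (Some Y) [] \<nu>) = prob G (Y, \<nu>)"
    using assms by (simp add: state_factor_def is_predicted_def)
  then show ?thesis
    using assms path_prob_nonneg[OF assms(1)] prob_nonneg[OF assms]
    by (simp add: truncated_prob_def predict_ext_def path_prob_append path_prob_single ennreal_mult
        flip: eSuc_enat)
qed

lemma truncated_prob_scan_ext:
  assumes "before s \<noteq> []"
  shows "truncated_prob G \<infinity> (scan_ext s p) = truncated_prob G \<infinity> p"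
  using assms by (simp add: truncated_prob_def scan_ext_def path_prob_append path_prob_single
      state_factor_moved)

text \<open>The final state has a moved dot and contributes the factor 1. Under truncation only an
  inequality holds, since the bound restricts the combined length of \<open>p\<close> and
  \<open>q\<close>. It is kept on \<open>q\<close>, the factor through which the unit recursion
  runs.\<close>

lemma truncated_prob_complete_ext:
  assumes "is_scfg G" "before s \<noteq> []"
  shows "truncated_prob G \<infinity> (complete_ext s p q) = truncated_prob G \<infinity> p * truncated_prob G \<infinity> q"
    and "truncated_prob G (eSuc N) (complete_ext s p q) \<le> truncated_prob G \<infinity> p * truncated_prob G N q"
proof -
  have *: "ennreal (path_prob G (complete_ext s p q)) = ennreal (path_prob G p) * ennreal (path_prob G q)"
    using assms path_prob_nonneg[OF assms(1)]
    by (simp add: complete_ext_def path_prob_append path_prob_single state_factor_moved ennreal_mult)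
  then show "truncated_prob G \<infinity> (complete_ext s p q) = truncated_prob G \<infinity> p * truncated_prob G \<infinity> q"
    by (simp add: truncated_prob_def)
  have "enat (length q) \<le> N" if "enat (length (complete_ext s p q)) \<le> eSuc N"
    using that by (cases N) (auto simp: complete_ext_def eSuc_enat)
  then show "truncated_prob G (eSuc N) (complete_ext s p q) \<le> truncated_prob G \<infinity> p * truncated_prob G N q"
    using * by (auto simp: truncated_prob_def)
qed

text \<open>Each single path is finite, so the truncations increase pointwise to the full weight and
  monotone convergence applies.\<close>

lemma nsum_truncated_SUP: "nsum (truncated_prob G \<infinity>) S = (SUP n. nsum (truncated_prob G (enat n)) S)"
proof -
  have "truncated_prob G \<infinity> p = (SUP n. truncated_prob G (enat n) p)" for p
  proof (rule antisym)
    show "truncated_prob G \<infinity> p \<le> (SUP n. truncated_prob G (enat n) p)"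
      by (rule SUP_upper2[of "length p"]) (auto simp: truncated_prob_def)
    show "(SUP n. truncated_prob G (enat n) p) \<le> truncated_prob G \<infinity> p"
      by (rule SUP_least) (simp add: truncated_prob_mono)
  qed
  then have "nsum (truncated_prob G \<infinity>) S = nsum (\<lambda>p. SUP n. truncated_prob G (enat n) p) S"
    by (intro nn_integral_cong)
  also have "\<dots> = (SUP n. nsum (truncated_prob G (enat n)) S)"
    by (rule nn_integral_monotone_convergence_SUP) (auto simp: incseq_def le_fun_def truncated_prob_mono)
  finally show ?thesis .
qed

lemma forward_sum_mono: "M \<le> N \<Longrightarrow> forward_sum G x M s \<le> forward_sum G x N s"
  unfolding forward_sum_def by (intro nn_integral_mono truncated_prob_mono)

lemma inner_sum_mono: "M \<le> N \<Longrightarrow> inner_sum G x M s \<le> inner_sum G x N s"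
  unfolding inner_sum_def by (intro nn_integral_mono truncated_prob_mono)

lemma paths_sum_complete:
  fixes G :: "('n::finite, 't::finite) scfg"
  assumes "is_scfg G" "no_null_productions G"
  shows "nsum (truncated_prob G \<infinity>) (paths_to G x h Q (State i k X (\<beta> @ [NT Z]) \<mu>)) =
      (\<Sum>j\<in>{k..<i}. \<Sum>\<nu> | (Z, \<nu>) \<in> prods G.
        nsum (truncated_prob G \<infinity>) (paths_to G x h Q (State j k X \<beta> (NT Z # \<mu>))) * inner_sum G x \<infinity> (State
            i j (Some Z) \<nu> []))"
    and "nsum (truncated_prob G (eSuc N)) (paths_to G x h Q (State i k X (\<beta> @ [NT Z]) \<mu>)) \<le>
      (\<Sum>j\<in>{k..<i}. \<Sum>\<nu> | (Z, \<nu>) \<in> prods G.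
        nsum (truncated_prob G \<infinity>) (paths_to G x h Q (State j k X \<beta> (NT Z # \<mu>))) * inner_sum G x N (State
            i j (Some Z) \<nu> []))"
proof -
  have *: "nsum (truncated_prob G \<infinity>) (paths_to G x h Q (State j k X \<beta> (NT Z # \<mu>))) * inner_sum G x N
      (State i j (Some Z) \<nu> []) =
     nsum (\<lambda>p. nsum (\<lambda>q. truncated_prob G \<infinity> p * truncated_prob G N q) (inner_paths G x (State i j (Some
         Z) \<nu> [])))
        (paths_to G x h Q (State j k X \<beta> (NT Z # \<mu>)))" for j \<nu> N
    by (simp add: inner_sum_def nn_integral_cmult nn_integral_multc)
  show "nsum (truncated_prob G \<infinity>) (paths_to G x h Q (State i k X (\<beta> @ [NT Z]) \<mu>)) =
      (\<Sum>j\<in>{k..<i}. \<Sum>\<nu> | (Z, \<nu>) \<in> prods G.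
        nsum (truncated_prob G \<infinity>) (paths_to G x h Q (State j k X \<beta> (NT Z # \<mu>))) * inner_sum G x \<infinity> (State
            i j (Some Z) \<nu> []))"
    unfolding * nsum_complete[OF assms] by (simp add: truncated_prob_complete_ext[OF assms(1)])
  show "nsum (truncated_prob G (eSuc N)) (paths_to G x h Q (State i k X (\<beta> @ [NT Z]) \<mu>)) \<le>
      (\<Sum>j\<in>{k..<i}. \<Sum>\<nu> | (Z, \<nu>) \<in> prods G.
        nsum (truncated_prob G \<infinity>) (paths_to G x h Q (State j k X \<beta> (NT Z # \<mu>))) * inner_sum G x N (State
            i j (Some Z) \<nu> []))"
    unfolding * nsum_complete[OF assms]
    by (intro sum_mono nn_integral_mono truncated_prob_complete_ext(2)[OF assms(1)]) simp
qed

lemma forward_sum_scan: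
  assumes "no_null_productions G" "i < length x" "a = x ! i"
  shows "forward_sum G x \<infinity> (State (Suc i) k X (\<beta> @ [Tm a]) \<mu>) = forward_sum G x \<infinity> (State i k X \<beta> (Tm a # \<mu>))"
  unfolding forward_sum_def forward_paths_eq nsum_scan[OF assms] by (simp add: truncated_prob_scan_ext)

lemma inner_sum_scan:
  assumes "no_null_productions G" "i < length x" "a = x ! i"
  shows "inner_sum G x \<infinity> (State (Suc i) k X (\<beta> @ [Tm a]) \<mu>) = inner_sum G x \<infinity> (State i k X \<beta> (Tm a # \<mu>))"
  unfolding inner_sum_def inner_paths_eq nsum_scan[OF assms] by (simp add: truncated_prob_scan_ext)

lemma forward_sum_complete:
  fixes G :: "('n::finite, 't::finite) scfg"
  assumes "is_scfg G" "no_null_productions G"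
  shows "forward_sum G x \<infinity> (State i k X (\<beta> @ [NT Z]) \<mu>) =
      (\<Sum>j\<in>{k..<i}. \<Sum>\<nu> | (Z, \<nu>) \<in> prods G.
        forward_sum G x \<infinity> (State j k X \<beta> (NT Z # \<mu>)) * inner_sum G x \<infinity> (State i j (Some Z) \<nu> []))"
  unfolding forward_sum_def forward_paths_eq by (rule paths_sum_complete[OF assms])

lemma inner_sum_complete:
  fixes G :: "('n::finite, 't::finite) scfg"
  assumes "is_scfg G" "no_null_productions G"
  shows "inner_sum G x \<infinity> (State i k X (\<beta> @ [NT Z]) \<mu>) =
      (\<Sum>j\<in>{k..<i}. \<Sum>\<nu> | (Z, \<nu>) \<in> prods G.
        inner_sum G x \<infinity> (State j k X \<beta> (NT Z # \<mu>)) * inner_sum G x \<infinity> (State i j (Some Z) \<nu> []))"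
    and "inner_sum G x (eSuc N) (State i k X (\<beta> @ [NT Z]) \<mu>) \<le>
      (\<Sum>j\<in>{k..<i}. \<Sum>\<nu> | (Z, \<nu>) \<in> prods G.
        inner_sum G x \<infinity> (State j k X \<beta> (NT Z # \<mu>)) * inner_sum G x N (State i j (Some Z) \<nu> []))"
proof -
  let ?h = "State k k X [] (\<beta> @ NT Z # \<mu>)"
  have *: "inner_paths G x (State i k X (\<beta> @ [NT Z]) \<mu>) = paths_to G x ?h (\<lambda>r. r = 0) (State i k X (\<beta> @
      [NT Z]) \<mu>)"
    "inner_paths G x (State j k X \<beta> (NT Z # \<mu>)) = paths_to G x ?h (\<lambda>r. r = 0) (State j k X \<beta> (NT Z #
        \<mu>))" for j
    by (simp_all add: inner_paths_eq)
  show "inner_sum G x \<infinity> (State i k X (\<beta> @ [NT Z]) \<mu>) =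
      (\<Sum>j\<in>{k..<i}. \<Sum>\<nu> | (Z, \<nu>) \<in> prods G.
        inner_sum G x \<infinity> (State j k X \<beta> (NT Z # \<mu>)) * inner_sum G x \<infinity> (State i j (Some Z) \<nu> []))"
    using paths_sum_complete(1)[OF assms, of x ?h "\<lambda>r. r = 0"] by (simp add: inner_sum_def[of _ _ _
        "State _ k _ _ _"] *)
  show "inner_sum G x (eSuc N) (State i k X (\<beta> @ [NT Z]) \<mu>) \<le>
      (\<Sum>j\<in>{k..<i}. \<Sum>\<nu> | (Z, \<nu>) \<in> prods G.
        inner_sum G x \<infinity> (State j k X \<beta> (NT Z # \<mu>)) * inner_sum G x N (State i j (Some Z) \<nu> []))"
    using paths_sum_complete(2)[OF assms, where h = ?h and Q = "\<lambda>r. r = 0"]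
    unfolding inner_sum_def[of _ _ _ "State i k _ _ _"] inner_sum_def[of _ _ _ "State _ k _ \<beta> _"] * .
qed

text \<open>A prediction appends exactly one state, so equality survives truncation; since
  \<open>eSuc \<infinity> = \<infinity>\<close>, the same statement contains the exact
  recurrence.\<close>

lemma forward_sum_predict:
  fixes G :: "('n::finite, 't::finite) scfg"
  assumes "is_scfg G" "no_null_productions G" "(Y, \<nu>) \<in> prods G"
  shows "forward_sum G x (eSuc N) (State i i (Some Y) [] \<nu>) =
    (\<Sum>(k, X, \<beta>, \<mu>)\<in>expecting G i Y. forward_sum G x N (State i k X \<beta> (NT Y # \<mu>))) * ennreal (prob G (Y, \<nu>))"
  unfolding forward_sum_def nsum_predict[OF assms] truncated_prob_predict_ext[OF assms(1,3)]
  by (simp add: nn_integral_multc sum_distrib_right case_prod_beta)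

lemma inner_sum_start:
  assumes "is_scfg G"
  shows "inner_sum G x \<infinity> (State i k X [] \<mu>) =
    (if start_state G (State i k X [] \<mu>) \<and> i = k then ennreal (state_factor G (State i k X [] \<mu>)) else 0)"
  by (auto simp: inner_sum_def inner_paths_start nsum_finite truncated_prob_def path_prob_single)

lemma inner_sum_eq_0:
  assumes "no_null_productions G" "pos s < origin s + length (before s)"
  shows "inner_sum G x N s = 0"
  using paths_to_empty[OF assms] by (simp add: inner_sum_def inner_paths_eq nsum_finite)

lemma forward_sum_eq_0:
  assumes "no_null_productions G" "\<not> is_state G s"
  shows "forward_sum G x N s = 0"
proof -
  have "forward_paths G x s = {}"
    using paths_to_state(1)[OF assms(1)] assms(2) unfolding forward_paths_eq by blast
  then show ?thesis by (simp add: forward_sum_def nsum_finite)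
qed

text \<open>\<open>is_state\<close> admits \<open>k < i\<close> with nothing before the dot, but
  only prediction creates an empty prefix, and it sets the origin to the current position.\<close>

lemma forward_sum_unmoved_eq_0:
  assumes "i \<noteq> k"
  shows "forward_sum G x N (State i k (Some X) [] \<mu>) = 0"
proof -
  have False if "earley_path G (initial_state G) p" "fst (last p) = State i k (Some X) [] \<mu>" for p
    using that by (cases rule: earley_path.cases) (use assms in \<open>auto simp: initial_state_def\<close>)
  then have "forward_paths G x (State i k (Some X) [] \<mu>) = {}"
    unfolding forward_paths_eq paths_to_def by blast
  then show ?thesis by (simp add: forward_sum_def nsum_finite)
qed

lemma forward_sum_initial:
  "forward_sum G x \<infinity> (initial_state G) = 1"
  by (simp add: forward_sum_def forward_paths_initial nsum_finite truncated_prob_def path_prob_single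
      state_factor_def is_predicted_def) (simp add: initial_state_def)

section \<open>Finiteness\<close>

lemma sum_unit_split:
  fixes G :: "('n::finite, 't::finite) scfg" and f :: "('n, 't) sym list \<Rightarrow> 'b::comm_monoid_add"
  assumes "is_scfg G" "no_null_productions G"
  shows "(\<Sum>\<nu> | (Z, \<nu>) \<in> prods G. f \<nu>) =
    (\<Sum>\<nu> | (Z, \<nu>) \<in> prods G \<and> (length \<nu> > 1 \<or> (\<exists>a. \<nu> = [Tm a])). f \<nu>) +
    (\<Sum>Y\<in>UNIV. if (Z, [NT Y]) \<in> prods G then f [NT Y] else 0)"
proof -
  let ?N = "{\<nu>. (Z, \<nu>) \<in> prods G \<and> (length \<nu> > 1 \<or> (\<exists>a. \<nu> = [Tm a]))}"
  let ?U = "(\<lambda>Y. [NT Y]) ` {Y. (Z, [NT Y]) \<in> prods G}"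
  have "\<nu> \<in> ?N \<or> \<nu> \<in> ?U" if "(Z, \<nu>) \<in> prods G" for \<nu>
  proof (cases \<nu>)
    case Nil
    then show ?thesis using that assms(2) by (auto simp: no_null_productions_def)
  next
    case (Cons c \<nu>')
    then show ?thesis using that by (cases c; cases \<nu>') auto
  qed
  then have "{\<nu>. (Z, \<nu>) \<in> prods G} = ?N \<union> ?U" by auto
  moreover have "finite ?N" using finite_rhs[OF assms(1), of Z] by (auto elim: rev_finite_subset)
  moreover have "?N \<inter> ?U = {}" by auto
  ultimately have "(\<Sum>\<nu> | (Z, \<nu>) \<in> prods G. f \<nu>) = sum f ?N + sum f ?U"
    by (simp add: sum.union_disjoint)
  also have "sum f ?U = (\<Sum>Y | (Z, [NT Y]) \<in> prods G. f [NT Y])"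
    by (subst sum.reindex) (auto simp: inj_on_def)
  also have "\<dots> = (\<Sum>Y\<in>UNIV. if (Z, [NT Y]) \<in> prods G then f [NT Y] else 0)"
    by (simp add: sum.If_cases)
  finally show ?thesis .
qed

section \<open>Completed expansions, the unit recursion and finiteness of inner sums\<close>

definition completed_sum :: "('n, 't) scfg \<Rightarrow> 't list \<Rightarrow> enat \<Rightarrow> nat \<Rightarrow> nat \<Rightarrow> 'n \<Rightarrow> ennreal" where
  "completed_sum G x N i k Z = (\<Sum>\<nu> | (Z, \<nu>) \<in> prods G. inner_sum G x N (State i k (Some Z) \<nu> []))"

lemma completed_sum_eq_0:
  assumes "no_null_productions G" "i \<le> k"
  shows "completed_sum G x N i k Z = 0"
  unfolding completed_sum_def
proof (intro sum.neutral ballI)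
  fix \<nu> assume "\<nu> \<in> {\<nu>. (Z, \<nu>) \<in> prods G}"
  then have "\<nu> \<noteq> []" using assms(1) by (auto simp: no_null_productions_def)
  then have "0 < length \<nu>" by simp
  then have "i < k + length \<nu>" using assms(2) by linarith
  then show "inner_sum G x N (State i k (Some Z) \<nu> []) = 0"
    by (intro inner_sum_eq_0[OF assms(1)]) simp
qed

text \<open>In the completion sum only \<open>j = k\<close> survives: with nothing before the dot no
  input has been covered, and the inner sum there is the probability of the unit production.\<close>

lemma inner_sum_unit:
  fixes G :: "('n::finite, 't::finite) scfg"
  assumes "is_scfg G" "no_null_productions G" "(Z, [NT Y]) \<in> prods G"
  shows "inner_sum G x \<infinity> (State i k (Some Z) [NT Y] []) = ennreal (unit_matrix G $ Z $ Y) *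
      completed_sum G x \<infinity> i k Y"
    and "inner_sum G x (eSuc N) (State i k (Some Z) [NT Y] []) \<le> ennreal (unit_matrix G $ Z $ Y) *
        completed_sum G x N i k Y"
proof -
  have "inner_sum G x \<infinity> (State j k (Some Z) [] [NT Y]) = (if j = k then ennreal (unit_matrix G $ Z $ Y)
      else 0)" for j
    using assms by (auto simp: inner_sum_start start_state_def is_predicted_def state_factor_def
        unit_matrix_def)
  then have "(\<Sum>j\<in>{k..<i}. \<Sum>\<nu> | (Y, \<nu>) \<in> prods G.
        inner_sum G x \<infinity> (State j k (Some Z) [] [NT Y]) * inner_sum G x N (State i j (Some Y) \<nu> [])) =
      (\<Sum>j\<in>{k..<i}. if j = k then ennreal (unit_matrix G $ Z $ Y) * completed_sum G x N i k Y else 0)" for N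
    by (intro sum.cong HOL.refl) (simp add: completed_sum_def sum_distrib_left)
  then have *: "(\<Sum>j\<in>{k..<i}. \<Sum>\<nu> | (Y, \<nu>) \<in> prods G.
        inner_sum G x \<infinity> (State j k (Some Z) [] [NT Y]) * inner_sum G x N (State i j (Some Y) \<nu> [])) =
      ennreal (unit_matrix G $ Z $ Y) * completed_sum G x N i k Y" for N
    \<comment> \<open>For \<open>i \<le> k\<close> the range of \<open>j\<close> is empty, and the
      right-hand side vanishes too.\<close>
    using completed_sum_eq_0[OF assms(2), of i k x N Y] by simp
  show "inner_sum G x \<infinity> (State i k (Some Z) [NT Y] []) = ennreal (unit_matrix G $ Z $ Y) * completed_sum
      G x \<infinity> i k Y"
    using inner_sum_complete(1)[OF assms(1,2), where \<beta> = "[]" and Z = Y and X = "Some Z"] * by simp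
  show "inner_sum G x (eSuc N) (State i k (Some Z) [NT Y] []) \<le> ennreal (unit_matrix G $ Z $ Y) *
      completed_sum G x N i k Y"
    using inner_sum_complete(2)[OF assms(1,2), where \<beta> = "[]" and \<mu> = "[]" and Z = Y and X = "Some Z"
        and x = x and N = N and i = i and k = k]
    by (simp only: append_Nil *)
qed

text \<open>With \<open>completed_sum\<close> as \<open>g\<close>, this is the \<open>h\<close> in
  \<open>g = h + P_U g\<close> for the span from \<open>k\<close> to \<open>i\<close>.\<close>

definition nonunit_sum :: "('n, 't) scfg \<Rightarrow> 't list \<Rightarrow> enat \<Rightarrow> nat \<Rightarrow> nat \<Rightarrow> 'n \<Rightarrow> ennreal" where
  "nonunit_sum G x N i k Z = (\<Sum>\<nu> | (Z, \<nu>) \<in> prods G \<and> (length \<nu> > 1 \<or> (\<exists>a. \<nu> = [Tm a])).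
     inner_sum G x N (State i k (Some Z) \<nu> []))"

lemma completed_sum_unfold:
  fixes G :: "('n::finite, 't::finite) scfg"
  assumes "is_scfg G" "no_null_productions G"
  shows "completed_sum G x \<infinity> i k Z =
      nonunit_sum G x \<infinity> i k Z + (\<Sum>Y\<in>UNIV. ennreal (unit_matrix G $ Z $ Y) * completed_sum G x \<infinity> i k Y)"
    and "completed_sum G x (eSuc N) i k Z \<le>
      nonunit_sum G x \<infinity> i k Z + (\<Sum>Y\<in>UNIV. ennreal (unit_matrix G $ Z $ Y) * completed_sum G x N i k Y)"
proof -
  note split = sum_unit_split[OF assms, where Z = Z]
  have 0: "unit_matrix G $ Z $ Y = 0" if "(Z, [NT Y]) \<notin> prods G" for Y
    using that by (simp add: unit_matrix_def)
  show "completed_sum G x \<infinity> i k Z =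
      nonunit_sum G x \<infinity> i k Z + (\<Sum>Y\<in>UNIV. ennreal (unit_matrix G $ Z $ Y) * completed_sum G x \<infinity> i k Y)"
    unfolding completed_sum_def[of _ _ _ _ _ Z] nonunit_sum_def split
    by (intro arg_cong2[where f = "(+)"] sum.cong HOL.refl) (use inner_sum_unit(1)[OF assms] 0 in \<open>auto\<close>)
  show "completed_sum G x (eSuc N) i k Z \<le>
      nonunit_sum G x \<infinity> i k Z + (\<Sum>Y\<in>UNIV. ennreal (unit_matrix G $ Z $ Y) * completed_sum G x N i k Y)"
    unfolding completed_sum_def[of _ _ _ _ _ Z] nonunit_sum_def split
    by (intro add_mono sum_mono) (use inner_sum_unit(2)[OF assms] 0 in \<open>auto intro!: inner_sum_mono\<close>)
qed

lemma truncated_0: "p \<noteq> [] \<Longrightarrow> truncated_prob G 0 p = 0"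
  by (simp add: truncated_prob_def zero_enat_def)

lemma nsum_truncated_0:
  assumes "\<And>p. p \<in> S \<Longrightarrow> p \<noteq> []"
  shows "nsum (truncated_prob G 0) S = 0"
  using assms truncated_0 by (subst nn_integral_0_iff_AE) (auto simp: AE_count_space)

lemma inner_sum_0: "inner_sum G x 0 s = 0"
  unfolding inner_sum_def by (rule nsum_truncated_0) (auto simp: inner_paths_def is_path_def)

lemma forward_sum_0: "forward_sum G x 0 s = 0"
  unfolding forward_sum_def by (rule nsum_truncated_0) (auto simp: forward_paths_def is_path_def)

lemma inner_sum_bounded_truncation:
  assumes "\<And>n. inner_sum G x (enat n) s \<le> B" "B < top"
  shows "inner_sum G x \<infinity> s < top"
proof -
  have "inner_sum G x \<infinity> s \<le> B"
    unfolding inner_sum_def nsum_truncated_SUP using assms(1) by (auto simp: inner_sum_def intro: SUP_least)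
  then show ?thesis using assms(2) by (rule order.strict_trans1)
qed

lemma forward_sum_bounded_truncation:
  assumes "\<And>n. forward_sum G x (enat n) s \<le> B" "B < top"
  shows "forward_sum G x \<infinity> s < top"
proof -
  have "forward_sum G x \<infinity> s \<le> B"
    unfolding forward_sum_def nsum_truncated_SUP using assms(1) by (auto simp: forward_sum_def intro:
        SUP_least)
  then show ?thesis using assms(2) by (rule order.strict_trans1)
qed

text \<open>Undoing the last scan or completion leads to strictly smaller spans unless the prefix is
  a lone nonterminal, whose expansion may cover the whole span.\<close>

lemma inner_sum_finite_step:
  fixes G :: "('n::finite, 't::finite) scfg"
  assumes G: "is_scfg G" "no_null_productions G"
    and IH: "\<And>s. pos s - origin s < d \<Longrightarrow> inner_sum G x \<infinity> s < top"
    and "i - k = d" "\<nexists>Z. \<beta> = [NT Z]"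
  shows "inner_sum G x \<infinity> (State i k X \<beta> \<mu>) < top"
proof (cases \<beta> rule: rev_cases)
  case Nil
  then show ?thesis using G by (simp add: inner_sum_start)
next
  case (snoc \<beta>' c)
  show ?thesis
  \<comment> \<open>In the terminal case an actual path is needed: it supplies the predecessor
    position and the agreement of \<open>a\<close> with the input.\<close>
  proof (cases "inner_paths G x (State i k X \<beta> \<mu>) = {}")
    case True
    then show ?thesis by (simp add: inner_sum_def nsum_finite)
  next
    case False
    show ?thesis
    proof (cases c)
      case (Tm a)
      then obtain p where "p \<in> paths_to G x (State k k X [] (\<beta>' @ Tm a # \<mu>)) (\<lambda>r. r = 0) (State i k X
          (\<beta>' @ [Tm a]) \<mu>)"
        using False snoc unfolding inner_paths_eq by auto
      from paths_to_scan_cases[OF G(2) this] obtain i' p' where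
        i': "i = Suc i'" "i' < length x" "a = x ! i'" and
        p': "p' \<in> paths_to G x (State k k X [] (\<beta>' @ Tm a # \<mu>)) (\<lambda>r. r = 0) (State i' k X \<beta>' (Tm a # \<mu>))" .
      have "k \<le> i'" using paths_to_state(3)[OF G(2) p'] by simp
      then have "inner_sum G x \<infinity> (State i' k X \<beta>' (Tm a # \<mu>)) < top"
        using i' \<open>i - k = d\<close> by (intro IH) simp
      then show ?thesis using inner_sum_scan[OF G(2) i'(2,3)] i'(1) snoc Tm by simp
    next
      case (NT Z)
      then have ne: "\<beta>' \<noteq> []" using snoc assms(5) by auto
      have "inner_sum G x \<infinity> (State j k X \<beta>' (NT Z # \<mu>)) * inner_sum G x \<infinity> (State i j (Some Z) \<nu> []) < top"
        if "j \<in> {k..<i}" for j \<nu>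
      proof (cases "j = k")
        case True
        \<comment> \<open>A nonempty prefix cannot fit into an empty span. The other factor has the
          full span and is not covered by the hypothesis, but \<open>0 * \<infinity> = 0\<close> in
          \<open>ennreal\<close>.\<close>
        then have "inner_sum G x \<infinity> (State j k X \<beta>' (NT Z # \<mu>)) = 0"
          using ne by (intro inner_sum_eq_0[OF G(2)]) simp
        then show ?thesis by simp
      next
        case False
        then show ?thesis using that assms(4)
          by (intro ennreal_mult_less_top[THEN iffD2] disjI2 conjI IH) auto
      qed
      then show ?thesis
        using finite_rhs[OF G(1), of Z] snoc NT by (simp add: inner_sum_complete(1)[OF G])
    qed
  qed
qed

text \<open>Within one span, non-unit productions are settled by the preceding step; the uniform
  bound then settles all complete states, and these in turn settle the states with a lone
  nonterminal before the dot.\<close>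

lemma inner_sum_finite:
  fixes G :: "('n::finite, 't::finite) scfg"
  assumes G: "is_scfg G" "no_null_productions G" and U: "summable (matrix_pow (unit_matrix G))"
  shows "inner_sum G x \<infinity> s < top"
proof (induction "pos s - origin s" arbitrary: s rule: less_induct)
  case less
  let ?d = "pos s - origin s"
  note step = inner_sum_finite_step[OF G, where d = ?d, OF less.hyps]
  have completed: "inner_sum G x \<infinity> (State i k (Some Z) \<nu> []) < top" if "i - k = ?d" "(Z, \<nu>) \<in> prods G"
      for i k Z \<nu>
  proof -
    define h where "h Z = enn2real (nonunit_sum G x \<infinity> i k Z)" for Z
    have h: "nonunit_sum G x \<infinity> i k Z = ennreal (h Z)" for Z
      using finite_rhs[OF G(1), of Z] unfolding h_def nonunit_sum_def
      by (subst ennreal_enn2real) (auto intro!: step simp: that(1))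
    have "completed_sum G x (enat n) i k Z \<le> ennreal (\<Sum>Y\<in>UNIV. suminf (matrix_pow (unit_matrix G)) $ Z $
        Y * h Y)" for n Z
    proof (rule bounded_by_suminf_matrix_pow[where u = "\<lambda>n. completed_sum G x (enat n) i k"])
      show "completed_sum G x (enat 0) i k Z = 0" for Z
        by (simp add: completed_sum_def inner_sum_0 flip: zero_enat_def)
      show "completed_sum G x (enat (Suc n)) i k Z \<le> ennreal (h Z) + (\<Sum>Y\<in>UNIV. ennreal (unit_matrix G $
          Z $ Y) * completed_sum G x (enat n) i k Y)" for n Z
        using completed_sum_unfold(2)[OF G, where N = "enat n" and x = x and i = i and k = k and Z = Z]
            by (simp add: h eSuc_enat)
    qed (simp_all add: U unit_matrix_nonneg G h_def)
    moreover have "inner_sum G x (enat n) (State i k (Some Z) \<nu> []) \<le> completed_sum G x (enat n) i k Z" for n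
      unfolding completed_sum_def using that finite_rhs[OF G(1), of Z]
      by (intro member_le_sum[of \<nu> _ "\<lambda>\<nu>. inner_sum G x (enat n) (State i k (Some Z) \<nu> [])"]) auto
    ultimately have "inner_sum G x (enat n) (State i k (Some Z) \<nu> []) \<le>
        ennreal (\<Sum>Y\<in>UNIV. suminf (matrix_pow (unit_matrix G)) $ Z $ Y * h Y)" for n
      by (rule order.trans[rotated])
    from inner_sum_bounded_truncation[OF this] show ?thesis by simp
  qed
  obtain i k X \<beta> \<mu> where s: "s = State i k X \<beta> \<mu>" by (cases s)
  show ?case
  proof (cases "\<exists>Z. \<beta> = [NT Z]")
    case False
    then show ?thesis unfolding s by (intro step) (auto simp: s)
  next
    case True
    then obtain Z where Z: "\<beta> = [NT Z]" by blast
    have "inner_sum G x \<infinity> (State j k X [] (NT Z # \<mu>)) * inner_sum G x \<infinity> (State i j (Some Z) \<nu> []) < top"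
      if "(Z, \<nu>) \<in> prods G" for j \<nu>
      using completed[OF _ that, of i j] G(1) by (cases "j = k") (auto simp: inner_sum_start s
          ennreal_mult_less_top)
    then show ?thesis
      using inner_sum_complete(1)[OF G, of x i k X "[]" Z \<mu>] finite_rhs[OF G(1), of Z] by (simp add: s Z)
  qed
qed

section \<open>Expected nonterminals, the left-corner recursion and finiteness of forward
  sums\<close>

definition kernel :: "('n, 't) scfg \<Rightarrow> nat \<Rightarrow> 'n \<Rightarrow> (nat \<times> 'n option \<times> ('n, 't) sym list \<times> ('n, 't) sym
    list) set" where
  "kernel G i Y = {(k, X, \<beta>, \<mu>). is_state G (State i k X \<beta> (NT Y # \<mu>)) \<and>
     (State i k X \<beta> (NT Y # \<mu>) = initial_state G \<or> \<beta> \<noteq> [])}"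

text \<open>Outside the kernel the prefix is empty and the left-hand side is a nonterminal. Origins
  other than \<open>i\<close> contribute 0, and the rest correspond to the productions whose
  right-hand side starts with \<open>Y\<close>, the ones that \<open>P_L\<close> collects.\<close>

lemma sum_expecting_split:
  fixes G :: "('n::finite, 't::finite) scfg" and f :: "('n, 't) state \<Rightarrow> 'b::comm_monoid_add"
  assumes "is_scfg G" "\<And>k X \<mu>. k \<noteq> i \<Longrightarrow> f (State i k (Some X) [] \<mu>) = 0"
  shows "(\<Sum>(k, X, \<beta>, \<mu>)\<in>expecting G i Y. f (State i k X \<beta> (NT Y # \<mu>))) =
    (\<Sum>(k, X, \<beta>, \<mu>)\<in>kernel G i Y. f (State i k X \<beta> (NT Y # \<mu>))) +
    (\<Sum>X\<in>UNIV. \<Sum>\<mu> | (X, NT Y # \<mu>) \<in> prods G. f (State i i (Some X) [] (NT Y # \<mu>)))"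
proof -
  let ?f = "\<lambda>(k, X, \<beta>, \<mu>). f (State i k X \<beta> (NT Y # \<mu>))"
  let ?P = "SIGMA X:UNIV. {\<mu>. (X, NT Y # \<mu>) \<in> prods G}"
  let ?g = "\<lambda>(X, \<mu>). (i, Some X, [] :: ('n, 't) sym list, \<mu>)"
  note fin = finite_expecting[OF assms(1), of i Y]
  have "kernel G i Y \<subseteq> expecting G i Y" by (auto simp: kernel_def expecting_def)
  then have "sum ?f (expecting G i Y) = sum ?f (expecting G i Y - kernel G i Y) + sum ?f (kernel G i Y)"
    by (rule sum.subset_diff[OF _ fin])
  also have "sum ?f (expecting G i Y - kernel G i Y) = sum ?f (?g ` ?P)"
  proof (rule sum.mono_neutral_right)
    show "finite (expecting G i Y - kernel G i Y)" using fin by simp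
    show "?g ` ?P \<subseteq> expecting G i Y - kernel G i Y"
      by (auto simp: expecting_def kernel_def initial_state_def)
    show "\<forall>z\<in>expecting G i Y - kernel G i Y - ?g ` ?P. ?f z = 0"
    proof
      fix z assume z: "z \<in> expecting G i Y - kernel G i Y - ?g ` ?P"
      obtain k X \<beta> \<mu> where z_eq: "z = (k, X, \<beta>, \<mu>)" by (metis surj_pair)
      have \<beta>: "\<beta> = []" and s: "is_state G (State i k X \<beta> (NT Y # \<mu>))" "State i k X \<beta> (NT Y # \<mu>) \<noteq>
          initial_state G"
        using z by (auto simp: z_eq expecting_def kernel_def)
      then obtain X' where X: "X = Some X'" by (cases X) auto
      then have "(X', NT Y # \<mu>) \<in> prods G" using s \<beta> by simp
      then have "k \<noteq> i" using z X \<beta> by (auto simp: z_eq image_iff)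
      then show "?f z = 0" using assms(2) X \<beta> by (simp add: z_eq)
    qed
  qed
  also have "\<dots> = (\<Sum>X\<in>UNIV. \<Sum>\<mu> | (X, NT Y # \<mu>) \<in> prods G. f (State i i (Some X) [] (NT Y # \<mu>)))"
    using finite_left_corner[OF assms(1)]
    by (subst sum.reindex) (auto simp: inj_on_def sum.Sigma case_prod_beta)
  finally show ?thesis by (simp add: add.commute)
qed

text \<open>This is the \<open>a\<close> in \<open>a = b + a P_L\<close> at position
  \<open>i\<close>, and \<open>kernel_sum\<close> is the \<open>b\<close>.\<close>

definition expected_sum :: "('n, 't) scfg \<Rightarrow> 't list \<Rightarrow> enat \<Rightarrow> nat \<Rightarrow> 'n \<Rightarrow> ennreal" where
  "expected_sum G x N i Y = (\<Sum>(k, X, \<beta>, \<mu>)\<in>expecting G i Y. forward_sum G x N (State i k X \<beta> (NT Y # \<mu>)))"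

definition kernel_sum :: "('n, 't) scfg \<Rightarrow> 't list \<Rightarrow> enat \<Rightarrow> nat \<Rightarrow> 'n \<Rightarrow> ennreal" where
  "kernel_sum G x N i Y = (\<Sum>(k, X, \<beta>, \<mu>)\<in>kernel G i Y. forward_sum G x N (State i k X \<beta> (NT Y # \<mu>)))"

text \<open>A predicted state for \<open>X\<close> weighs the expected sum of \<open>X\<close> times
  the probability of its production. Summing over the productions that start with \<open>Y\<close>
  turns these probabilities into the matrix entry.\<close>

lemma expected_sum_unfold:
  fixes G :: "('n::finite, 't::finite) scfg"
  assumes "is_scfg G" "no_null_productions G"
  shows "expected_sum G x (eSuc N) i Y =
    kernel_sum G x (eSuc N) i Y + (\<Sum>X\<in>UNIV. ennreal (left_corner_matrix G $ X $ Y) * expected_sum G x N i X)"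
proof -
  have "(\<Sum>\<mu> | (X, NT Y # \<mu>) \<in> prods G. forward_sum G x (eSuc N) (State i i (Some X) [] (NT Y # \<mu>))) =
      ennreal (left_corner_matrix G $ X $ Y) * expected_sum G x N i X" for X
  proof -
    have "(\<Sum>\<mu> | (X, NT Y # \<mu>) \<in> prods G. forward_sum G x (eSuc N) (State i i (Some X) [] (NT Y # \<mu>))) =
        (\<Sum>\<mu> | (X, NT Y # \<mu>) \<in> prods G. expected_sum G x N i X * ennreal (prob G (X, NT Y # \<mu>)))"
    proof (intro sum.cong HOL.refl)
      fix \<mu> assume "\<mu> \<in> {\<mu>. (X, NT Y # \<mu>) \<in> prods G}"
      then show "forward_sum G x (eSuc N) (State i i (Some X) [] (NT Y # \<mu>)) =
          expected_sum G x N i X * ennreal (prob G (X, NT Y # \<mu>))"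
        using forward_sum_predict[OF assms, of X "NT Y # \<mu>"] unfolding expected_sum_def by blast
    qed
    also have "\<dots> = expected_sum G x N i X * (\<Sum>\<mu> | (X, NT Y # \<mu>) \<in> prods G. ennreal (prob G (X, NT Y # \<mu>)))"
      by (rule sum_distrib_left[symmetric])
    also have "(\<Sum>\<mu> | (X, NT Y # \<mu>) \<in> prods G. ennreal (prob G (X, NT Y # \<mu>))) = ennreal
        (left_corner_matrix G $ X $ Y)"
      using prob_nonneg[OF assms(1)] by (subst sum_ennreal) (auto simp: left_corner_matrix_def)
    finally show ?thesis by (simp add: mult.commute)
  qed
  then show ?thesis
    unfolding expected_sum_def[of _ _ "eSuc N"] kernel_sum_def
    using sum_expecting_split[OF assms(1), of i "forward_sum G x (eSuc N)" Y]
    by (simp add: forward_sum_unmoved_eq_0)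
qed

lemma finite_kernel:
  fixes G :: "('n::finite, 't::finite) scfg"
  assumes "is_scfg G"
  shows "finite (kernel G i Y)"
  by (rule finite_subset[OF _ finite_expecting[OF assms, of i Y]]) (auto simp: kernel_def expecting_def)

text \<open>By induction on the position, states with a moved dot are finite, hence so is the
  kernel. The uniform bound then covers all states expecting a nonterminal, and one more prediction
  step covers the predicted states.\<close>

lemma forward_sum_finite:
  fixes G :: "('n::finite, 't::finite) scfg"
  assumes G: "is_scfg G" "no_null_productions G"
    and U: "summable (matrix_pow (unit_matrix G))" and L: "summable (matrix_pow (left_corner_matrix G))"
  shows "forward_sum G x \<infinity> s < top"
proof (induction "pos s" arbitrary: s rule: less_induct)
  case less
  have moved: "forward_sum G x \<infinity> (State i k X \<beta> \<mu>) < top" if i: "i = pos s" and \<beta>: "\<beta> \<noteq> []" for i k X \<beta> \<mu>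
  proof (cases "forward_paths G x (State i k X \<beta> \<mu>) = {}")
    case True
    then show ?thesis by (simp add: forward_sum_def nsum_finite)
  next
    case False
    obtain \<beta>' c where snoc: "\<beta> = \<beta>' @ [c]" using \<beta> by (cases \<beta> rule: rev_cases) auto
    show ?thesis
    proof (cases c)
      case (Tm a)
      then obtain p where "p \<in> paths_to G x (initial_state G) (\<lambda>_. True) (State i k X (\<beta>' @ [Tm a]) \<mu>)"
        using False snoc unfolding forward_paths_eq by auto
      from paths_to_scan_cases[OF G(2) this] obtain i' p' where
        i': "i = Suc i'" "i' < length x" "a = x ! i'" .
      have "forward_sum G x \<infinity> (State i' k X \<beta>' (Tm a # \<mu>)) < top"
        using i' i by (intro less.hyps) simp
      then show ?thesis using forward_sum_scan[OF G(2) i'(2,3)] i'(1) snoc Tm by simp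
    next
      case (NT Z)
      have "forward_sum G x \<infinity> (State j k X \<beta>' (NT Z # \<mu>)) * inner_sum G x \<infinity> (State i j (Some Z) \<nu> []) < top"
        if "j \<in> {k..<i}" for j \<nu>
        using that i inner_sum_finite[OF G U] less.hyps[of "State j k X \<beta>' (NT Z # \<mu>)"]
        by (simp add: ennreal_mult_less_top)
      then show ?thesis
        using finite_rhs[OF G(1), of Z] snoc NT by (simp add: forward_sum_complete[OF G])
    qed
  qed
  define h where "h Y = enn2real (kernel_sum G x \<infinity> (pos s) Y)" for Y
  have "forward_sum G x \<infinity> (State (pos s) k X \<beta> (NT Y # \<mu>)) < top" if "(k, X, \<beta>, \<mu>) \<in> kernel G (pos s) Y"
      for k X \<beta> \<mu> Y
  proof (cases "\<beta> = []")
    case True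
    then have "State (pos s) k X \<beta> (NT Y # \<mu>) = initial_state G" using that by (simp add: kernel_def)
    then show ?thesis by (simp only: forward_sum_initial ennreal_one_less_top)
  qed (rule moved[OF HOL.refl])
  then have "kernel_sum G x \<infinity> (pos s) Y < top" for Y
    using finite_kernel[OF G(1), of "pos s" Y] unfolding kernel_sum_def by auto
  then have h: "kernel_sum G x \<infinity> (pos s) Y = ennreal (h Y)" for Y by (simp add: h_def)
  let ?B = "\<lambda>Y. ennreal (\<Sum>Z\<in>UNIV. suminf (matrix_pow (transpose (left_corner_matrix G))) $ Y $ Z * h Z)"
  have bound: "expected_sum G x (enat n) (pos s) Y \<le> ?B Y" for n Y
  proof (rule bounded_by_suminf_matrix_pow[where u = "\<lambda>n. expected_sum G x (enat n) (pos s)"])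
    show "summable (matrix_pow (transpose (left_corner_matrix G)))"
      by (rule summable_matrix_pow_transpose[OF L])
    show "0 \<le> transpose (left_corner_matrix G) $ X $ Y" for X Y
      using left_corner_matrix_nonneg[OF G(1)] by (simp add: transpose_def)
    show "expected_sum G x (enat 0) (pos s) Y = 0" for Y
      by (simp add: expected_sum_def forward_sum_0 case_prod_beta flip: zero_enat_def)
    fix n Y
    have "kernel_sum G x (eSuc (enat n)) (pos s) Y \<le> ennreal (h Y)"
      unfolding h[symmetric] kernel_sum_def by (intro sum_mono) (auto intro: forward_sum_mono)
    then show "expected_sum G x (enat (Suc n)) (pos s) Y \<le> ennreal (h Y) +
        (\<Sum>X\<in>UNIV. ennreal (transpose (left_corner_matrix G) $ Y $ X) * expected_sum G x (enat n) (pos s) X)"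
      unfolding eSuc_enat[symmetric] expected_sum_unfold[OF G] by (simp add: transpose_def add_right_mono)
  qed (simp add: h_def)
  obtain i k X \<beta> \<mu> where s: "s = State i k X \<beta> \<mu>" by (cases s)
  show ?case
  proof (cases "\<beta> = [] \<and> is_state G s \<and> s \<noteq> initial_state G")
    case False
    then show ?thesis
      using moved[of i \<beta> k X \<mu>] forward_sum_eq_0[OF G(2), of s x \<infinity>] forward_sum_initial[of G x] s
      by (cases "\<beta> = []") auto
  next
    case True
    then obtain Y where Y: "X = Some Y" "(Y, \<mu>) \<in> prods G" using s by (cases X) auto
    show ?thesis
    proof (cases "i = k")
      case False
      then show ?thesis using s Y True by (simp add: forward_sum_unmoved_eq_0)
    next
      case ik: True
      have "forward_sum G x (enat n) s \<le> ?B Y * ennreal (prob G (Y, \<mu>))" for n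
      proof -
        have "forward_sum G x (enat n) s \<le> forward_sum G x (eSuc (enat n)) s"
          by (intro forward_sum_mono) (simp add: eSuc_enat)
        also have "\<dots> = expected_sum G x (enat n) (pos s) Y * ennreal (prob G (Y, \<mu>))"
          using forward_sum_predict[OF G Y(2)] s Y ik True by (simp add: expected_sum_def)
        also have "\<dots> \<le> ?B Y * ennreal (prob G (Y, \<mu>))" by (intro mult_right_mono bound) simp
        finally show ?thesis .
      qed
      then show ?thesis by (rule forward_sum_bounded_truncation) (simp add: ennreal_mult_less_top)
    qed
  qed
qed

section \<open>Recurrences for forward and inner probabilities\<close>

text \<open>A nonnegative function with finite integral is absolutely summable, so the real infinite
  sums in the definitions are genuine values rather than the default 0.\<close>

lemma
  assumes "is_scfg G" "nsum (truncated_prob G \<infinity>) S < top"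
  shows summable_path_prob: "path_prob G summable_on S"
    and infsum_path_prob: "(\<Sum>\<^sub>\<infinity>p\<in>S. path_prob G p) = enn2real (nsum (truncated_prob G \<infinity>) S)"
proof -
  have fin: "nsum (\<lambda>p. ennreal (path_prob G p)) S < \<infinity>"
    using assms(2) unfolding truncated_prob_infinity[abs_def] by simp
  then have "integrable (count_space S) (path_prob G)"
    using path_prob_nonneg[OF assms(1)] by (intro integrableI_nonneg) auto
  then have *: "Infinite_Set_Sum.abs_summable_on (path_prob G) S"
    by (simp add: Infinite_Set_Sum.abs_summable_on_def)
  then show "path_prob G summable_on S"
    using abs_summable_equivalent abs_summable_summable by blast
  show "(\<Sum>\<^sub>\<infinity>p\<in>S. path_prob G p) = enn2real (nsum (truncated_prob G \<infinity>) S)"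
    using infsetsum_infsum[OF *] infsetsum_conv_nn_integral[of S "path_prob G"] fin path_prob_nonneg[OF
        assms(1)]
    unfolding truncated_prob_infinity[abs_def] by simp
qed

lemma enn2real_sum:
  assumes "\<And>a. a \<in> A \<Longrightarrow> f a < top"
  shows "enn2real (\<Sum>a\<in>A. f a) = (\<Sum>a\<in>A. enn2real (f a))"
  using assms by (induction A rule: infinite_finite_induct) (auto simp: enn2real_plus)

lemma enn2real_sum_mult:
  assumes "\<And>a. f a < top" "\<And>a. g a < top"
  shows "enn2real (\<Sum>a\<in>A. f a * g a) = (\<Sum>a\<in>A. enn2real (f a) * enn2real (g a))"
  using assms by (simp add: enn2real_sum enn2real_mult ennreal_mult_less_top)

context
  fixes G :: "('n::finite, 't::finite) scfg" and x :: "'t list"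
  assumes G: "is_scfg G" "proper G" "no_useless_nonterminals G" "no_null_productions G"
begin

lemma forward_sum_less_top: "forward_sum G x \<infinity> s < top"
  using forward_sum_finite[OF G(1,4) summable_unit[OF G(1-3)] summable_left_corner[OF G(1-3)]] .

lemma inner_sum_less_top: "inner_sum G x \<infinity> s < top"
  using inner_sum_finite[OF G(1,4) summable_unit[OF G(1-3)]] .

lemma completed_sum_less_top: "completed_sum G x \<infinity> i k Z < top"
  using finite_rhs[OF G(1), of Z] by (simp add: completed_sum_def inner_sum_less_top)

lemma nonunit_sum_less_top: "nonunit_sum G x \<infinity> i k Z < top"
  using finite_rhs[OF G(1), of Z] by (simp add: nonunit_sum_def inner_sum_less_top)

lemma expected_sum_less_top: "expected_sum G x \<infinity> i Y < top"
  using finite_expecting[OF G(1), of i Y] by (auto simp: expected_sum_def forward_sum_less_top)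

lemma kernel_sum_less_top: "kernel_sum G x \<infinity> i Y < top"
  using finite_kernel[OF G(1), of i Y] by (auto simp: kernel_sum_def forward_sum_less_top)

lemma forward_prob_eq: "forward_prob G x s = enn2real (forward_sum G x \<infinity> s)"
  unfolding forward_prob_def forward_sum_def
  by (rule infsum_path_prob[OF G(1) forward_sum_less_top[unfolded forward_sum_def]])

lemma inner_prob_eq: "inner_prob G x s = enn2real (inner_sum G x \<infinity> s)"
  unfolding inner_prob_def inner_sum_def
  by (rule infsum_path_prob[OF G(1) inner_sum_less_top[unfolded inner_sum_def]])

text \<open>Finiteness lets \<open>enn2real\<close> carry \<open>g = h + P_U g\<close> over to the
  reals, where it can be solved. The sum over \<open>Y\<close> and the sum over its right-hand sides
  then merge into one over productions.\<close>

lemma completed_sum_R_U: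
  "enn2real (completed_sum G x \<infinity> i k Z) =
    (\<Sum>(Y, \<nu>) | (Y, \<nu>) \<in> prods G \<and> (length \<nu> > 1 \<or> (\<exists>a. \<nu> = [Tm a])).
      inner_prob G x (State i k (Some Y) \<nu> []) * R_U G $ Z $ Y)"
proof -
  have "enn2real (completed_sum G x \<infinity> i k Z) = enn2real (nonunit_sum G x \<infinity> i k Z) +
      (\<Sum>Y\<in>UNIV. unit_matrix G $ Z $ Y * enn2real (completed_sum G x \<infinity> i k Y))" for Z
    by (subst completed_sum_unfold(1)[OF G(1,4)])
      (simp add: enn2real_plus enn2real_sum_mult nonunit_sum_less_top completed_sum_less_top
        ennreal_mult_less_top unit_matrix_nonneg[OF G(1)])
  from suminf_matrix_pow_solve_left[OF summable_unit[OF G(1-3)], OF this]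
  have "enn2real (completed_sum G x \<infinity> i k Z) = (\<Sum>Y\<in>UNIV. R_U G $ Z $ Y * enn2real (nonunit_sum G x \<infinity> i k Y))"
    by (simp add: R_U_def)
  also have "\<dots> = (\<Sum>Y\<in>UNIV. \<Sum>\<nu> | (Y, \<nu>) \<in> prods G \<and> (length \<nu> > 1 \<or> (\<exists>a. \<nu> = [Tm a])).
      inner_prob G x (State i k (Some Y) \<nu> []) * R_U G $ Z $ Y)"
    by (simp add: nonunit_sum_def enn2real_sum inner_sum_less_top inner_prob_eq sum_distrib_left mult.commute)
  also have "\<dots> = (\<Sum>(Y, \<nu>)\<in>(SIGMA Y:UNIV. {\<nu>. (Y, \<nu>) \<in> prods G \<and> (length \<nu> > 1 \<or> (\<exists>a. \<nu> = [Tm a]))}).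
      inner_prob G x (State i k (Some Y) \<nu> []) * R_U G $ Z $ Y)"
    by (rule sum.Sigma) (auto intro: finite_subset[OF _ finite_rhs[OF G(1)]])
  also have "(SIGMA Y:UNIV. {\<nu>. (Y, \<nu>) \<in> prods G \<and> (length \<nu> > 1 \<or> (\<exists>a. \<nu> = [Tm a]))}) =
      {(Y, \<nu>). (Y, \<nu>) \<in> prods G \<and> (length \<nu> > 1 \<or> (\<exists>a. \<nu> = [Tm a]))}"
    by auto
  finally show ?thesis .
qed

lemma forward_prob_complete:
  "forward_prob G x (State i k X (\<beta> @ [NT Z]) \<mu>) =
    (\<Sum>j = k..<i. \<Sum>(Y, \<nu>) | (Y, \<nu>) \<in> prods G \<and> (length \<nu> > 1 \<or> (\<exists>a. \<nu> = [Tm a])).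
      forward_prob G x (State j k X \<beta> (NT Z # \<mu>)) * inner_prob G x (State i j (Some Y) \<nu> []) * R_U G $ Z $ Y)"
proof -
  have "forward_prob G x (State i k X (\<beta> @ [NT Z]) \<mu>) =
      enn2real (\<Sum>j = k..<i. forward_sum G x \<infinity> (State j k X \<beta> (NT Z # \<mu>)) * completed_sum G x \<infinity> i j Z)"
    by (simp add: forward_prob_eq forward_sum_complete[OF G(1,4)] completed_sum_def sum_distrib_left)
  then show ?thesis
    by (simp add: enn2real_sum_mult forward_sum_less_top completed_sum_less_top completed_sum_R_U
        forward_prob_eq sum_distrib_left case_prod_beta mult.assoc)
qed

lemma inner_prob_complete:
  "inner_prob G x (State i k X (\<beta> @ [NT Z]) \<mu>) =
    (\<Sum>j = k..<i. \<Sum>(Y, \<nu>) | (Y, \<nu>) \<in> prods G \<and> (length \<nu> > 1 \<or> (\<exists>a. \<nu> = [Tm a])).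
      inner_prob G x (State j k X \<beta> (NT Z # \<mu>)) * inner_prob G x (State i j (Some Y) \<nu> []) * R_U G $ Z $ Y)"
proof -
  have "inner_prob G x (State i k X (\<beta> @ [NT Z]) \<mu>) =
      enn2real (\<Sum>j = k..<i. inner_sum G x \<infinity> (State j k X \<beta> (NT Z # \<mu>)) * completed_sum G x \<infinity> i j Z)"
    by (simp add: inner_prob_eq inner_sum_complete(1)[OF G(1,4)] completed_sum_def sum_distrib_left)
  then show ?thesis
    by (simp add: enn2real_sum_mult inner_sum_less_top completed_sum_less_top completed_sum_R_U
        inner_prob_eq sum_distrib_left case_prod_beta mult.assoc)
qed

text \<open>At \<open>N = \<infinity>\<close> the truncated recurrence becomes a fixed point
  equation. It is solved in transposed form, and transposing the series back gives the entry from
  \<open>Z\<close> to \<open>Y\<close>.\<close>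

lemma expected_sum_R_L:
  "enn2real (expected_sum G x \<infinity> i Y) = (\<Sum>Z\<in>UNIV. R_L G $ Z $ Y * enn2real (kernel_sum G x \<infinity> i Z))"
proof -
  note L = summable_left_corner[OF G(1-3)]
  have unfold: "expected_sum G x \<infinity> i Y =
      kernel_sum G x \<infinity> i Y + (\<Sum>X\<in>UNIV. ennreal (left_corner_matrix G $ X $ Y) * expected_sum G x \<infinity> i X)" for Y
    using expected_sum_unfold[OF G(1,4), of x \<infinity> i Y] by (simp only: eSuc_infinity)
  have "enn2real (expected_sum G x \<infinity> i Y) = enn2real (kernel_sum G x \<infinity> i Y) +
      (\<Sum>X\<in>UNIV. transpose (left_corner_matrix G) $ Y $ X * enn2real (expected_sum G x \<infinity> i X))" for Y
    by (subst unfold) (simp add: enn2real_plus enn2real_sum_mult kernel_sum_less_top expected_sum_less_top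
        ennreal_mult_less_top left_corner_matrix_nonneg[OF G(1)] transpose_def)
  from suminf_matrix_pow_solve_left[OF summable_matrix_pow_transpose[OF L], OF this]
  show ?thesis
    unfolding suminf_matrix_pow_transpose[OF L] by (simp add: R_L_def transpose_def)
qed

lemma forward_prob_predict:
  assumes "(Y, \<nu>) \<in> prods G"
  shows "forward_prob G x (State i i (Some Y) [] \<nu>) =
    (\<Sum>(k, X, \<beta>, Z, \<mu>) | is_state G (State i k X \<beta> (NT Z # \<mu>)) \<and>
        (State i k X \<beta> (NT Z # \<mu>) = initial_state G \<or> \<beta> \<noteq> []).
      forward_prob G x (State i k X \<beta> (NT Z # \<mu>)) * R_L G $ Z $ Y * prob G (Y, \<nu>))"
proof -
  let ?f = "\<lambda>Z (k, X, \<beta>, \<mu>). forward_prob G x (State i k X \<beta> (NT Z # \<mu>)) * R_L G $ Z $ Y * prob G (Y, \<nu>)"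
  have "forward_prob G x (State i i (Some Y) [] \<nu>) = enn2real (expected_sum G x \<infinity> i Y) * prob G (Y, \<nu>)"
    using forward_sum_predict[OF G(1,4) assms, of x \<infinity> i] prob_nonneg[OF G(1) assms]
    by (simp add: forward_prob_eq expected_sum_def enn2real_mult)
  also have "\<dots> = (\<Sum>Z\<in>UNIV. \<Sum>z\<in>kernel G i Z. ?f Z z)"
    unfolding expected_sum_R_L sum_distrib_right
  proof (rule sum.cong[OF HOL.refl])
    fix Z :: 'n
    have "enn2real (kernel_sum G x \<infinity> i Z) =
        (\<Sum>(k, X, \<beta>, \<mu>)\<in>kernel G i Z. forward_prob G x (State i k X \<beta> (NT Z # \<mu>)))"
      unfolding kernel_sum_def forward_prob_eq
      by (subst enn2real_sum) (auto simp: forward_sum_less_top case_prod_beta)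
    then show "R_L G $ Z $ Y * enn2real (kernel_sum G x \<infinity> i Z) * prob G (Y, \<nu>) = (\<Sum>z\<in>kernel G i Z. ?f Z z)"
      by (simp add: sum_distrib_left sum_distrib_right case_prod_beta mult.commute)
  qed
  also have "\<dots> = (\<Sum>(Z, z)\<in>(SIGMA Z:UNIV. kernel G i Z). ?f Z z)"
    by (rule sum.Sigma) (auto intro: finite_kernel[OF G(1)])
  also have "\<dots> = (\<Sum>(k, X, \<beta>, Z, \<mu>) | is_state G (State i k X \<beta> (NT Z # \<mu>)) \<and>
        (State i k X \<beta> (NT Z # \<mu>) = initial_state G \<or> \<beta> \<noteq> []).
      forward_prob G x (State i k X \<beta> (NT Z # \<mu>)) * R_L G $ Z $ Y * prob G (Y, \<nu>))"
    by (rule sum.reindex_bij_witness[of _ "\<lambda>(k, X, \<beta>, Z, \<mu>). (Z, k, X, \<beta>, \<mu>)" "\<lambda>(Z, k, X, \<beta>, \<mu>). (k, X,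
        \<beta>, Z, \<mu>)"])
      (auto simp: kernel_def)
  finally show ?thesis .
qed

lemma inner_prob_predict:
  assumes "(Y, \<nu>) \<in> prods G"
  shows "inner_prob G x (State i i (Some Y) [] \<nu>) = prob G (Y, \<nu>)"
  using assms prob_nonneg[OF G(1) assms]
  by (simp add: inner_prob_eq inner_sum_start[OF G(1)] start_state_def is_predicted_def state_factor_def)

lemma forward_prob_initial: "forward_prob G x (initial_state G) = 1"
  by (simp add: forward_prob_eq forward_sum_initial)

lemma inner_prob_initial: "inner_prob G x (State 0 0 None [] [NT (start G)]) = 1"
  by (simp add: inner_prob_eq inner_sum_start[OF G(1)] start_state_def initial_state_def
      is_predicted_def state_factor_def)

end

theorem mainTheorem3:
  fixes G :: "('n::finite, 't::finite) scfg" and x :: "'t list"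
  assumes "is_scfg G"
    and "proper G"
    and "consistent G"
    and "no_useless_nonterminals G"
    and "no_null_productions G"
  shows
    \<comment> \<open>the infinite sums defining \<open>R_L\<close>, \<open>R_U\<close>, \<open>forward_prob\<close> and \<open>inner_prob\<close> converge\<close>
    "summable (matrix_pow (left_corner_matrix G)) \<and> summable (matrix_pow (unit_matrix G)) \<and>
     (\<forall>s. path_prob G summable_on forward_paths G x s \<and> path_prob G summable_on inner_paths G x s) \<and>
     forward_prob G x (State 0 0 None [] [NT (start G)]) = 1 \<and>
     inner_prob G x (State 0 0 None [] [NT (start G)]) = 1 \<and>
     (\<forall>i Y \<nu>. i \<le> length x \<and> (Y, \<nu>) \<in> prods G \<and> State i i (Some Y) [] \<nu> \<in> chart G x \<longrightarrow>
        forward_prob G x (State i i (Some Y) [] \<nu>) =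
          (\<Sum>(k, X, \<beta>, Z, \<mu>) | is_state G (State i k X \<beta> (NT Z # \<mu>)) \<and>
               (State i k X \<beta> (NT Z # \<mu>) = initial_state G \<or> \<beta> \<noteq> []).
             forward_prob G x (State i k X \<beta> (NT Z # \<mu>)) * R_L G $ Z $ Y * prob G (Y, \<nu>)) \<and>
        inner_prob G x (State i i (Some Y) [] \<nu>) = prob G (Y, \<nu>)) \<and>
     (\<forall>i k X \<beta> a \<mu>. i < length x \<and> State i k X \<beta> (Tm a # \<mu>) \<in> chart G x \<and> a = x ! i \<longrightarrow>
        forward_prob G x (State (i + 1) k X (\<beta> @ [Tm a]) \<mu>) =
          forward_prob G x (State i k X \<beta> (Tm a # \<mu>)) \<and>
        inner_prob G x (State (i + 1) k X (\<beta> @ [Tm a]) \<mu>) =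
          inner_prob G x (State i k X \<beta> (Tm a # \<mu>))) \<and>
     (\<forall>i k X \<beta> Z \<mu>. State i k X (\<beta> @ [NT Z]) \<mu> \<in> chart G x \<longrightarrow>
        forward_prob G x (State i k X (\<beta> @ [NT Z]) \<mu>) =
          (\<Sum>j = k..<i. \<Sum>(Y, \<nu>) | (Y, \<nu>) \<in> prods G \<and> (length \<nu> > 1 \<or> (\<exists>a. \<nu> = [Tm a])).
             forward_prob G x (State j k X \<beta> (NT Z # \<mu>)) *
             inner_prob G x (State i j (Some Y) \<nu> []) * R_U G $ Z $ Y) \<and>
        inner_prob G x (State i k X (\<beta> @ [NT Z]) \<mu>) =
          (\<Sum>j = k..<i. \<Sum>(Y, \<nu>) | (Y, \<nu>) \<in> prods G \<and> (length \<nu> > 1 \<or> (\<exists>a. \<nu> = [Tm a])).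
             inner_prob G x (State j k X \<beta> (NT Z # \<mu>)) *
             inner_prob G x (State i j (Some Y) \<nu> []) * R_U G $ Z $ Y))"
proof (intro conjI allI impI)
  note G = assms(1,2,4,5)
  show "summable (matrix_pow (left_corner_matrix G))" by (rule summable_left_corner[OF G(1-3)])
  show "summable (matrix_pow (unit_matrix G))" by (rule summable_unit[OF G(1-3)])
  show "path_prob G summable_on forward_paths G x s" for s
    by (rule summable_path_prob[OF G(1) forward_sum_less_top[OF G, unfolded forward_sum_def]])
  show "path_prob G summable_on inner_paths G x s" for s
    by (rule summable_path_prob[OF G(1) inner_sum_less_top[OF G, unfolded inner_sum_def]])
  show "forward_prob G x (State 0 0 None [] [NT (start G)]) = 1"
    using forward_prob_initial[OF G] by (simp add: initial_state_def)
  show "inner_prob G x (State 0 0 None [] [NT (start G)]) = 1"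
    by (rule inner_prob_initial[OF G])
qed (use forward_prob_predict[OF assms(1,2,4,5)] inner_prob_predict[OF assms(1,2,4,5)]
    forward_prob_complete[OF assms(1,2,4,5)] inner_prob_complete[OF assms(1,2,4,5)] in
    \<open>auto simp: forward_prob_eq[OF assms(1,2,4,5)] inner_prob_eq[OF assms(1,2,4,5)]
      forward_sum_scan[OF assms(5)] inner_sum_scan[OF assms(5)]\<close>)

end
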